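(* Let $\alpha\in\left(0,\tfrac{\pi}{2}\right)$ and let $\phi\colon P(\mathbb{C}^2)\to P(\mathbb{C}^2)$ be a bijective map such that $$\measuredangle([u],[v])=\alpha \iff \measuredangle(\phi([u]),\phi([v]))=\alpha \quad ([u],[v]\in P(\mathbb{C}^2)).$$ Then (i) if $\alpha\neq\tfrac{\pi}{4}$, $\phi$ is a Wigner symmetry, i.e. there exists a bijective linear or conjugate-linear isometry $U\colon\mathbb{C}^2\to\mathbb{C}^2$ such that $\phi([v])=[Uv]$ for every $[v]\in P(\mathbb{C}^2)$; (ii) if $\alpha=\tfrac{\pi}{4}$, there exists a unitary or an antiunitary operator $U\colon\mathbb{C}^2\to\mathbb{C}^2$ such that $$\phi([v])\in\left\{[Uv],[Uv]^\perp\right\}\quad([v]\in P(\mathbb{C}^2)).$$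
   Context: $\mathbb{C}^2$ carries its standard inner product. $P(\mathbb{C}^2)$ is the set of all one-dimensional (complex) subspaces (lines) of $\mathbb{C}^2$; for $0\neq v\in\mathbb{C}^2$, $[v]$ is the line generated by $v$, and $[v]^\perp$ denotes the unique line orthogonal to $[v]$. The angle between lines is $\measuredangle([u],[v])=\arccos\frac{|\langle u,v\rangle|}{\|u\|\,\|v\|}\in\left[0,\tfrac{\pi}{2}\right]$. *)

theory Defs
  imports "HOL-Analysis.Analysis"
begin

definition cinner :: "complex^2 \<Rightarrow> complex^2 \<Rightarrow> complex"
  where "cinner u v = (\<Sum>i\<in>UNIV. u $ i * cnj (v $ i))"

text \<open>The library norm on \<open>complex^2\<close> is the one induced by this inner product.\<close>

lemma cinner_self: "cinner v v = complex_of_real ((norm v)\<^sup>2)"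
  by (simp add: cinner_def norm_vec_def L2_set_def sum_nonneg complex_norm_square
      del: of_real_power)

definition lines :: "(complex^2) set set"
  where "lines = {L. vec.subspace L \<and> vec.dim L = 1}"

definition line :: "complex^2 \<Rightarrow> (complex^2) set"
  where "line v = vec.span {v}"

definition perp_line :: "(complex^2) set \<Rightarrow> (complex^2) set"
  where "perp_line L = (THE M. M \<in> lines \<and> (\<forall>u\<in>L. \<forall>v\<in>M. cinner u v = 0))"

text \<open>The angle does not depend on the chosen generators; see \<open>line_angle_line\<close> below.\<close>

definition line_angle :: "(complex^2) set \<Rightarrow> (complex^2) set \<Rightarrow> real"
  where "line_angle L M = (THE \<theta>. \<exists>u v. u \<noteq> 0 \<and> v \<noteq> 0 \<and> L = line u \<and> M = line v \<and>
           \<theta> = arccos (cmod (cinner u v) / (norm u * norm v)))"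

definition clinear_map :: "(complex^2 \<Rightarrow> complex^2) \<Rightarrow> bool"
  where "clinear_map U \<longleftrightarrow> Vector_Spaces.linear (*s) (*s) U"

definition conj_linear_map :: "(complex^2 \<Rightarrow> complex^2) \<Rightarrow> bool"
  where "conj_linear_map U \<longleftrightarrow>
    (\<forall>x y. U (x + y) = U x + U y) \<and> (\<forall>c x. U (c *s x) = cnj c *s U x)"

definition isometry :: "(complex^2 \<Rightarrow> complex^2) \<Rightarrow> bool"
  where "isometry U \<longleftrightarrow> (\<forall>x y. dist (U x) (U y) = dist x y)"

definition unitary :: "(complex^2 \<Rightarrow> complex^2) \<Rightarrow> bool"
  where "unitary U \<longleftrightarrow> clinear_map U \<and> bij U \<and> (\<forall>x y. cinner (U x) (U y) = cinner x y)"

definition antiunitary :: "(complex^2 \<Rightarrow> complex^2) \<Rightarrow> bool"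
  where "antiunitary U \<longleftrightarrow>
    conj_linear_map U \<and> bij U \<and> (\<forall>x y. cinner (U x) (U y) = cnj (cinner x y))"

definition wigner_symmetry :: "((complex^2) set \<Rightarrow> (complex^2) set) \<Rightarrow> bool"
  where "wigner_symmetry \<phi> \<longleftrightarrow>
    (\<exists>U. bij U \<and> (clinear_map U \<or> conj_linear_map U) \<and> isometry U \<and>
         (\<forall>v. v \<noteq> 0 \<longrightarrow> \<phi> (line v) = line (U v)))"

lemma line_eq: "line v = range (\<lambda>c. c *s v)"
  by (simp add: line_def vec.span_singleton)

lemma line_in_lines:
  assumes "v \<noteq> 0" shows "line v \<in> lines"
proof -
  have "vec.dim (vec.span {v}) = 1"
    using assms by (simp add: vec.dim_eq_card_independent)
  then show ?thesis by (simp add: lines_def line_def)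
qed

lemma in_lines_iff: "L \<in> lines \<longleftrightarrow> (\<exists>v. v \<noteq> 0 \<and> L = line v)"
proof
  assume "L \<in> lines"
  then have L: "vec.subspace L" "vec.dim L = 1" by (auto simp: lines_def)
  obtain B where B: "B \<subseteq> L" "vec.independent B" "L \<subseteq> vec.span B" "card B = vec.dim L"
    using vec.basis_exists[of L] by metis
  from B(4) L(2) obtain v where v: "B = {v}" by (auto simp: card_1_singleton_iff)
  have "L = line v"
    using B v L(1) vec.span_minimal[of B L] by (auto simp: line_def)
  moreover have "v \<noteq> 0" using B(2) v by simp
  ultimately show "\<exists>v. v \<noteq> 0 \<and> L = line v" by blast
qed (auto simp: line_in_lines)

lemma line_eqD:
  assumes "v \<noteq> 0" "line v = line w"
  obtains c where "c \<noteq> 0" "v = c *s w"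
proof -
  have "v \<in> line v" by (simp add: line_def vec.span_base)
  with assms(2) obtain c where "v = c *s w" by (auto simp: line_eq)
  moreover from this assms(1) have "c \<noteq> 0" by auto
  ultimately show ?thesis using that by blast
qed

lemma cinner_scale: "cinner (a *s u) (b *s v) = a * cnj b * cinner u v"
  by (simp add: cinner_def sum_distrib_left mult_ac)

lemma norm_smult: "norm (a *s (u :: complex^2)) = cmod a * norm u"
  by (simp add: norm_vec_def norm_mult L2_set_right_distrib)

lemma line_angle_line:
  assumes "u \<noteq> 0" "v \<noteq> 0"
  shows "line_angle (line u) (line v) = arccos (cmod (cinner u v) / (norm u * norm v))"
  unfolding line_angle_def
proof (rule the_equality)
  fix \<theta>
  assume "\<exists>u' v'. u' \<noteq> 0 \<and> v' \<noteq> 0 \<and> line u = line u' \<and> line v = line v' \<and>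
            \<theta> = arccos (cmod (cinner u' v') / (norm u' * norm v'))"
  then obtain u' v' where *: "line u = line u'" "line v = line v'"
      "\<theta> = arccos (cmod (cinner u' v') / (norm u' * norm v'))" by blast
  obtain a b where ab: "a \<noteq> 0" "u = a *s u'" "b \<noteq> 0" "v = b *s v'"
    using line_eqD[OF assms(1) *(1)] line_eqD[OF assms(2) *(2)] by metis
  show "\<theta> = arccos (cmod (cinner u v) / (norm u * norm v))"
    using ab(1,3) by (simp add: *(3) ab(2,4) cinner_scale norm_smult norm_mult)
qed (use assms in blast)

lemma perp_line_unique:
  assumes "L \<in> lines"
  shows "\<exists>!M. M \<in> lines \<and> (\<forall>u\<in>L. \<forall>v\<in>M. cinner u v = 0)"
proof -
  from assms obtain u where u: "u \<noteq> 0" "L = line u" by (auto simp: in_lines_iff)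
  define w :: "complex^2" where "w = vector [- cnj (u $ 2), cnj (u $ 1)]"
  have w12: "w $ 1 = - cnj (u $ 2)" "w $ 2 = cnj (u $ 1)" by (simp_all add: w_def)
  have w0: "w \<noteq> 0" using u(1) w12 by (auto simp: vec_eq_iff forall_2)
  have uw: "cinner u w = 0" by (simp add: cinner_def sum_2 w12)
  show ?thesis
  proof (rule ex1I)
    show "line w \<in> lines \<and> (\<forall>x\<in>L. \<forall>y\<in>line w. cinner x y = 0)"
      using line_in_lines[OF w0] uw by (auto simp: u(2) line_eq[of u] line_eq[of w] cinner_scale)
  next
    fix M assume M: "M \<in> lines \<and> (\<forall>x\<in>L. \<forall>y\<in>M. cinner x y = 0)"
    then obtain v where v: "v \<noteq> 0" "M = line v" by (auto simp: in_lines_iff)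
    have "u \<in> L" "v \<in> M" by (simp_all add: u(2) v(2) line_def vec.span_base)
    with M have "cinner u v = 0" by blast
    then have "cnj (cinner u v) = 0" by simp
    then have eq: "cnj (u $ 1) * v $ 1 + cnj (u $ 2) * v $ 2 = 0"
      by (simp add: cinner_def sum_2)
    have "\<exists>c. v = c *s w"
    proof (cases "u $ 1 = 0")
      case True
      then have "u $ 2 \<noteq> 0" using u(1) by (auto simp: vec_eq_iff forall_2)
      then show ?thesis using eq True
        by (intro exI[of _ "- v $ 1 / cnj (u $ 2)"]) (auto simp: vec_eq_iff forall_2 w12)
    next
      case False
      then have "v $ 1 = - (cnj (u $ 2) * v $ 2) / cnj (u $ 1)"
        using eq by (simp add: field_simps add_eq_0_iff)
      then show ?thesis using False
        by (intro exI[of _ "v $ 2 / cnj (u $ 1)"]) (auto simp: vec_eq_iff forall_2 w12)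
    qed
    then obtain c where c: "v = c *s w" by blast
    with v(1) have "c \<noteq> 0" by auto
    then have "line v = line w" 
      unfolding c line_def by (subst vec.span_image_scale[of "{w}" "\<lambda>_. c", simplified]) auto
    then show "M = line w" using v by simp
  qed
qed

end

theory Submission
  imports Defs
begin

text \<open>
  Lines of \<open>\<complex>\<^sup>2\<close> correspond to points of the Bloch sphere, and lines at angle \<open>\<alpha>\<close> to points with
  inner product \<open>c = cos (2 * \<alpha>)\<close>. So \<open>\<phi>\<close> becomes a bijection \<open>f\<close> of the sphere that preserves
  \<open>x \<bullet> y = c\<close> in both directions, and every relation that is definable from this one is
  preserved as well.

  If \<open>c \<noteq> 0\<close>, counting the common neighbours of two points shows that \<open>f\<close> preserves a comparison
  ``the angle of \<open>x\<close> and \<open>y\<close> is at most \<open>a\<close>''. The set of such \<open>a\<close> is closed under sums and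
  differences. If it contains arbitrarily small angles, \<open>f\<close> is an isometry. Otherwise its minimum
  can only be \<open>\<pi> / 2\<close> or \<open>2 * \<pi> / 3\<close>, and \<open>f\<close> preserves orthogonality.

  A map of the sphere that preserves orthogonality is an orthogonal map up to signs (fundamental
  theorem of projective geometry, and the reals have no nontrivial ring endomorphism); if moreover
  some \<open>c \<noteq> 0\<close> with \<open>2 * c\<^sup>2 \<le> 1\<close> is preserved, the sign is constant. Finally, orthogonal maps of the
  sphere lift to unitary or antiunitary maps of \<open>\<complex>\<^sup>2\<close>.
\<close>

subsection \<open>Common neighbours on the sphere\<close>

lemma cross3_orthogonal_eq_0:
  fixes a b u v :: "real^3"
  assumes "a \<noteq> 0" "b \<noteq> 0" "a \<bullet> b = 0"
    and "u \<bullet> a = 0" "u \<bullet> b = 0" "v \<bullet> a = 0" "v \<bullet> b = 0"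
  shows "cross3 u v = 0"
proof (rule ccontr)
  define w where "w = cross3 u v"
  assume "cross3 u v \<noteq> 0"
  then have w: "w \<bullet> w \<noteq> 0" by (simp add: w_def)
  have *: "(w \<bullet> w) * (x \<bullet> x) = (x \<bullet> w)\<^sup>2" if "u \<bullet> x = 0" "v \<bullet> x = 0" for x
  proof -
    have "cross3 x w = 0"
      using that by (simp add: w_def Lagrange inner_commute)
    then show ?thesis
      using norm_cross_dot[of x w]
      by (simp add: dot_square_norm power_mult_distrib mult.commute)
  qed
  have "x = ((x \<bullet> w) / (w \<bullet> w)) *\<^sub>R w" if "u \<bullet> x = 0" "v \<bullet> x = 0" for x
  proof -
    have "(x - ((x \<bullet> w) / (w \<bullet> w)) *\<^sub>R w) \<bullet> (x - ((x \<bullet> w) / (w \<bullet> w)) *\<^sub>R w) = 0"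
      using w *[OF that] by (simp add: inner_simps inner_commute field_simps power2_eq_square)
    then show ?thesis by simp
  qed
  then obtain k l where "a = k *\<^sub>R w" "b = l *\<^sub>R w"
    using assms by meson
  then show False using assms(1-3) w by auto
qed

lemma unit_inner_eq_1:
  fixes x y :: "'a::euclidean_space"
  assumes "norm x = 1" "norm y = 1"
  shows "x \<bullet> y = 1 \<longleftrightarrow> x = y"
  using norm_cauchy_schwarz_eq[of x y] assms by auto

lemma four_cycle:
  fixes p q r s :: "real^3"
  assumes "norm p = 1" "norm q = 1" "norm r = 1" "norm s = 1" "p \<noteq> q" "r \<noteq> s"
    and "p \<bullet> r = c" "p \<bullet> s = c" "q \<bullet> r = c" "q \<bullet> s = c"
  shows "(1 + p \<bullet> q) * (1 + r \<bullet> s) = 4 * c\<^sup>2"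
proof -
  have n: "p \<bullet> p = 1" "q \<bullet> q = 1" "r \<bullet> r = 1" "s \<bullet> s = 1"
    using assms(1-4) by (simp_all add: norm_eq_1)
  have "cross3 (p + q) (r + s) = 0"
    by (rule cross3_orthogonal_eq_0[of "p - q" "r - s"])
       (use assms n in \<open>auto simp: inner_simps inner_commute\<close>)
  then have "((p + q) \<bullet> (p + q)) * ((r + s) \<bullet> (r + s)) = ((p + q) \<bullet> (r + s))\<^sup>2"
    using norm_cross_dot[of "p + q" "r + s"]
    by (simp add: dot_square_norm power_mult_distrib)
  then show ?thesis
    using assms n by (simp add: inner_simps inner_commute power2_eq_square algebra_simps)
qed

lemma ex_unit_normal:
  fixes p q :: "real^3"
  shows "\<exists>n. norm n = 1 \<and> n \<bullet> p = 0 \<and> n \<bullet> q = 0"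
proof -
  have "\<exists>m. m \<noteq> 0 \<and> m \<bullet> p = 0 \<and> m \<bullet> q = 0"
  proof -
    have "dim (span {p, q}) < DIM(real^3)"
      using dim_le_card'[of "{p, q}"] card_insert_le_m1[of 2 "{q}" p] by simp
    then obtain m where m: "m \<noteq> 0" "\<And>y. y \<in> span (span {p, q}) \<Longrightarrow> orthogonal m y"
      using orthogonal_to_subspace_exists by (metis dim_span)
    have "orthogonal m p" "orthogonal m q"
      using m(2) by (simp_all add: span_base)
    with m(1) show ?thesis by (auto simp: orthogonal_def)
  qed
  then obtain m where "m \<noteq> 0" "m \<bullet> p = 0" "m \<bullet> q = 0" by blast
  then show ?thesis by (intro exI[of _ "m /\<^sub>R norm m"]) simp
qed

lemma common_neighbours:
  fixes p q :: "real^3"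
  assumes "norm p = 1" "norm q = 1" "c \<noteq> 0" "2 * c\<^sup>2 - 1 \<le> p \<bullet> q"
  obtains r s where "norm r = 1" "norm s = 1" "p \<bullet> r = c" "p \<bullet> s = c" "q \<bullet> r = c" "q \<bullet> s = c"
    "2 * c\<^sup>2 - 1 < p \<bullet> q \<Longrightarrow> r \<noteq> s"
proof -
  define k where "k = p \<bullet> q"
  have k: "2 * c\<^sup>2 \<le> 1 + k" "0 < 1 + k"
    using assms(4) zero_less_power2[of c] assms(3) unfolding k_def by linarith+
  obtain n where n: "norm n = 1" "n \<bullet> p = 0" "n \<bullet> q = 0" using ex_unit_normal by blast
  define l where "l = c / (1 + k)"
  define m where "m = sqrt (1 - 2 * c\<^sup>2 / (1 + k))"
  have m2: "m\<^sup>2 = 1 - 2 * c\<^sup>2 / (1 + k)" using k by (simp add: m_def)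
  have l: "l * (1 + k) = c" using k(2) by (simp add: l_def)
  have n2: "n \<bullet> n = 1" "p \<bullet> p = 1" "q \<bullet> q = 1" using n(1) assms by (simp_all add: norm_eq_1)
  have unit: "norm (l *\<^sub>R (p + q) + t *\<^sub>R n) = 1" if "t\<^sup>2 = m\<^sup>2" for t
  proof -
    have "(l *\<^sub>R (p + q) + t *\<^sub>R n) \<bullet> (l *\<^sub>R (p + q) + t *\<^sub>R n) = l\<^sup>2 * (2 + 2 * k) + t\<^sup>2"
      using n n2 by (simp add: inner_simps inner_commute k_def power2_eq_square algebra_simps)
    also have "\<dots> = 1"
    proof -
      have "l\<^sup>2 * (2 + 2 * k) = 2 * c * l" using l by (simp add: power2_eq_square algebra_simps flip: l)
      moreover have "2 * c\<^sup>2 / (1 + k) = 2 * c * l" by (simp add: l_def power2_eq_square)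
      ultimately show ?thesis unfolding that m2 by simp
    qed
    finally show ?thesis by (simp add: norm_eq_1)
  qed
  have inn: "p \<bullet> (l *\<^sub>R (p + q) + t *\<^sub>R n) = c" "q \<bullet> (l *\<^sub>R (p + q) + t *\<^sub>R n) = c" for t
    using l n n2 by (simp_all add: inner_simps inner_commute k_def add.commute)
  have "l *\<^sub>R (p + q) + m *\<^sub>R n \<noteq> l *\<^sub>R (p + q) + (- m) *\<^sub>R n" if "2 * c\<^sup>2 - 1 < p \<bullet> q"
  proof -
    have "m \<noteq> 0" using that k by (simp add: m_def k_def)
    moreover have "n \<noteq> 0" using n by auto
    ultimately have "(m - - m) *\<^sub>R n \<noteq> 0" by simp
    then show ?thesis unfolding scaleR_diff_left by auto
  qed
  then show ?thesis
    using that[OF unit[of m] unit[of "- m"] inn(1) inn(1) inn(2) inn(2)] by simp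
qed

lemma common_neighbour_bound:
  fixes p q r :: "real^3"
  assumes "norm p = 1" "norm q = 1" "norm r = 1" "p \<bullet> r = c" "q \<bullet> r = c"
  shows "2 * c\<^sup>2 - 1 \<le> p \<bullet> q"
proof -
  have "p \<bullet> p = 1" "q \<bullet> q = 1" "r \<bullet> r = 1"
    using assms(1-3) by (simp_all add: norm_eq_1)
  then show ?thesis
    using Cauchy_Schwarz_ineq[of "p + q" r] assms
    by (simp add: inner_simps inner_commute power2_eq_square)
qed

definition preserves_eq :: "(real^3 \<Rightarrow> real^3) \<Rightarrow> real \<Rightarrow> bool"
  where "preserves_eq f t \<longleftrightarrow>
    (\<forall>x\<in>sphere 0 1. \<forall>y\<in>sphere 0 1. x \<bullet> y = t \<longleftrightarrow> f x \<bullet> f y = t)"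

definition preserves_order :: "(real^3 \<Rightarrow> real^3) \<Rightarrow> real \<Rightarrow> bool"
  where "preserves_order f t \<longleftrightarrow>
    (\<forall>x\<in>sphere 0 1. \<forall>y\<in>sphere 0 1.
      (t \<le> x \<bullet> y \<longleftrightarrow> t \<le> f x \<bullet> f y) \<and> (t < x \<bullet> y \<longleftrightarrow> t < f x \<bullet> f y))"

lemma preserves_order_imp_eq: "preserves_order f t \<Longrightarrow> preserves_eq f t"
  unfolding preserves_order_def preserves_eq_def by (metis order_le_less order_less_irrefl)

lemma definable_invariant:
  assumes f: "bij_betw f S S" and "x \<in> S" "y \<in> S"
    and R: "\<And>x y. x \<in> S \<Longrightarrow> y \<in> S \<Longrightarrow> R x y \<longleftrightarrow> (\<exists>r\<in>S. \<exists>s\<in>S. Q x y r s)"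
    and Q: "\<And>r s. r \<in> S \<Longrightarrow> s \<in> S \<Longrightarrow> Q x y r s \<longleftrightarrow> Q (f x) (f y) (f r) (f s)"
  shows "R x y \<longleftrightarrow> R (f x) (f y)"
proof -
  have ex: "(\<exists>r\<in>S. P r) \<longleftrightarrow> (\<exists>r\<in>S. P (f r))" for P
    using f by (metis bij_betwE bij_betw_imp_surj_on imageE)
  have "f x \<in> S" "f y \<in> S" using assms(2,3) f by (meson bij_betwE)+
  then have "R (f x) (f y) \<longleftrightarrow> (\<exists>r\<in>S. \<exists>s\<in>S. Q (f x) (f y) (f r) (f s))"
    by (simp only: R[OF \<open>f x \<in> S\<close> \<open>f y \<in> S\<close>] ex[of "\<lambda>r. \<exists>s\<in>S. Q (f x) (f y) r s"]
      ex[of "\<lambda>s. Q (f x) (f y) (f r) s" for r])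
  moreover have "(\<exists>r\<in>S. \<exists>s\<in>S. Q x y r s) \<longleftrightarrow> (\<exists>r\<in>S. \<exists>s\<in>S. Q (f x) (f y) (f r) (f s))"
    using Q by (intro bex_cong refl)
  ultimately show ?thesis unfolding R[OF assms(2,3)] by simp
qed

lemma preserves_order_double:
  assumes f: "bij_betw f (sphere 0 1) (sphere 0 1)" and c: "preserves_eq f c" "c \<noteq> 0" "c\<^sup>2 < 1"
  shows "preserves_order f (2 * c\<^sup>2 - 1)"
proof -
  let ?S = "sphere (0::real^3) 1"
  let ?N = "\<lambda>x y r s. x \<bullet> r = c \<and> y \<bullet> r = c \<and> x \<bullet> s = c \<and> y \<bullet> s = c"
  have self: "2 * c\<^sup>2 - 1 < x \<bullet> x" if "x \<in> ?S" for x
    using that c(3) by (simp add: norm_eq_1)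
  have ge: "2 * c\<^sup>2 - 1 \<le> x \<bullet> y \<longleftrightarrow> (\<exists>r\<in>?S. \<exists>s\<in>?S. ?N x y r s)"
    if "x \<in> ?S" "y \<in> ?S" for x y
  proof -
    have n: "norm x = 1" "norm y = 1" using that by auto
    show ?thesis
    proof
      assume "2 * c\<^sup>2 - 1 \<le> x \<bullet> y"
      from common_neighbours[OF n c(2) this] show "\<exists>r\<in>?S. \<exists>s\<in>?S. ?N x y r s"
        by (metis dist_0_norm mem_sphere)
    next
      assume "\<exists>r\<in>?S. \<exists>s\<in>?S. ?N x y r s"
      then show "2 * c\<^sup>2 - 1 \<le> x \<bullet> y"
        using common_neighbour_bound[OF n] by auto
    qed
  qed
  have gt: "2 * c\<^sup>2 - 1 < x \<bullet> y \<longleftrightarrow> (\<exists>r\<in>?S. \<exists>s\<in>?S. x = y \<or> r \<noteq> s \<and> ?N x y r s)"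
    if xy: "x \<in> ?S" "y \<in> ?S" for x y
  proof
    assume *: "2 * c\<^sup>2 - 1 < x \<bullet> y"
    have n: "norm x = 1" "norm y = 1" using xy by auto
    from common_neighbours[OF n c(2) less_imp_le[OF *]] *
    obtain r s where "r \<in> ?S" "s \<in> ?S" "r \<noteq> s" "?N x y r s"
      by (metis dist_0_norm mem_sphere)
    then show "\<exists>r\<in>?S. \<exists>s\<in>?S. x = y \<or> r \<noteq> s \<and> ?N x y r s" by blast
  next
    assume "\<exists>r\<in>?S. \<exists>s\<in>?S. x = y \<or> r \<noteq> s \<and> ?N x y r s"
    then consider "x = y" | r s where "r \<in> ?S" "s \<in> ?S" "x \<noteq> y" "r \<noteq> s" "?N x y r s" by blast
    then show "2 * c\<^sup>2 - 1 < x \<bullet> y"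
    proof cases
      case 1
      then show ?thesis using self xy by simp
    next
      case 2
      have "(1 + x \<bullet> y) * (1 + r \<bullet> s) = 4 * c\<^sup>2"
        by (rule four_cycle) (use 2 xy in auto)
      moreover have "2 * c\<^sup>2 - 1 \<le> x \<bullet> y"
        using common_neighbour_bound[of x y r c] 2 xy by auto
      moreover have "r \<bullet> s \<noteq> 1" using 2 by (auto simp: unit_inner_eq_1)
      ultimately show ?thesis using c(2) by (cases "x \<bullet> y = 2 * c\<^sup>2 - 1") auto
    qed
  qed
  have fi: "f x = f y \<longleftrightarrow> x = y" if "x \<in> ?S" "y \<in> ?S" for x y
    using f that by (meson bij_betw_imp_inj_on inj_on_eq_iff)
  have fc: "f x \<bullet> f y = c \<longleftrightarrow> x \<bullet> y = c" if "x \<in> ?S" "y \<in> ?S" for x y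
    using c(1) that unfolding preserves_eq_def by blast
  show ?thesis
    unfolding preserves_order_def
  proof (intro ballI conjI)
    fix x y assume xy: "x \<in> ?S" "y \<in> ?S"
    show "2 * c\<^sup>2 - 1 \<le> x \<bullet> y \<longleftrightarrow> 2 * c\<^sup>2 - 1 \<le> f x \<bullet> f y"
      by (rule definable_invariant[OF f xy ge]) (use xy in \<open>simp_all only: fc\<close>)
    show "2 * c\<^sup>2 - 1 < x \<bullet> y \<longleftrightarrow> 2 * c\<^sup>2 - 1 < f x \<bullet> f y"
      by (rule definable_invariant[OF f xy gt]) (use xy in \<open>simp_all only: fc fi\<close>)
  qed
qed

lemma preserves_order_rhombus:
  assumes f: "bij_betw f (sphere 0 1) (sphere 0 1)" and c: "preserves_eq f c" "c \<noteq> 0"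
    and t: "preserves_order f t" "2 * c\<^sup>2 - 1 < t" "t < 1"
  shows "preserves_order f (4 * c\<^sup>2 / (1 + t) - 1)"
proof -
  let ?S = "sphere (0::real^3) 1"
  let ?N = "\<lambda>x y r s. x \<bullet> r = c \<and> y \<bullet> r = c \<and> x \<bullet> s = c \<and> y \<bullet> s = c"
  define u where "u = 4 * c\<^sup>2 / (1 + t) - 1"
  have c2: "0 < c\<^sup>2" using c(2) by simp
  then have t0: "0 < 1 + t" using t(2) by linarith
  have u: "(1 + u) * (1 + t) = 4 * c\<^sup>2" using t0 by (simp add: u_def)
  have u1: "u < 1" using t(2) t0 by (simp add: u_def field_simps)
  have u2: "2 * c\<^sup>2 - 1 < u"
  proof -
    have "2 * c\<^sup>2 * (1 + t) < 4 * c\<^sup>2" using c2 t(3) by simp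
    then show ?thesis using t0 by (simp add: u_def pos_less_divide_eq)
  qed
  have cmp: "u \<le> k' \<longleftrightarrow> k \<le> t" "u < k' \<longleftrightarrow> k < t"
    if "(1 + k') * (1 + k) = 4 * c\<^sup>2" "0 < 1 + k'" for k k'
  proof -
    have *: "(1 + u) * (1 + t) = (1 + k') * (1 + k)" using that u by simp
    have k: "0 < 1 + k" using that c2 by (metis zero_less_mult_pos zero_less_mult_iff zero_less_numeral)
    have "u \<le> k' \<Longrightarrow> k \<le> t"
    proof (rule ccontr)
      assume "u \<le> k'" "\<not> k \<le> t"
      then have "(1 + u) * (1 + t) < (1 + k') * (1 + k)"
        using that(2) t0 by (intro mult_le_less_imp_less) (use u2 c2 in linarith)+
      then show False using * by simp
    qed
    moreover have "u > k' \<Longrightarrow> k > t"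
    proof (rule ccontr)
      assume "u > k'" "\<not> k > t"
      then have "(1 + k') * (1 + k) < (1 + u) * (1 + t)"
        using that(2) k by (intro mult_less_le_imp_less) auto
      then show False using * by simp
    qed
    moreover have "u = k' \<longleftrightarrow> k = t" using * that(2) t0 by auto
    ultimately show "u \<le> k' \<longleftrightarrow> k \<le> t" "u < k' \<longleftrightarrow> k < t" by linarith+
  qed
  have main: "(P (x \<bullet> y) \<longleftrightarrow> (\<exists>r\<in>?S. \<exists>s\<in>?S. x = y \<or> r \<noteq> s \<and> ?N x y r s \<and> Q (r \<bullet> s)))"
    if xy: "x \<in> ?S" "y \<in> ?S" and P: "P 1" "\<And>k. P k \<Longrightarrow> u \<le> k"
      and PQ: "\<And>k k'. (1 + k') * (1 + k) = 4 * c\<^sup>2 \<Longrightarrow> 0 < 1 + k' \<Longrightarrow> P k' \<longleftrightarrow> Q k" for x y P Q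
  proof (cases "x = y")
    case True
    then show ?thesis using xy P by (auto simp: norm_eq_1)
  next
    case False
    have n: "norm x = 1" "norm y = 1" using xy by auto
    have *: "P (x \<bullet> y) \<longleftrightarrow> Q (r \<bullet> s)" if "r \<in> ?S" "s \<in> ?S" "r \<noteq> s" "?N x y r s" for r s
    proof (rule PQ)
      show "(1 + x \<bullet> y) * (1 + r \<bullet> s) = 4 * c\<^sup>2"
        by (rule four_cycle) (use that n False in auto)
      show "0 < 1 + x \<bullet> y"
        using common_neighbour_bound[OF n, of r c] that c2 unfolding mem_sphere dist_0_norm by linarith
    qed
    have "\<exists>r\<in>?S. \<exists>s\<in>?S. r \<noteq> s \<and> ?N x y r s" if "P (x \<bullet> y)"
    proof -
      have "2 * c\<^sup>2 - 1 < x \<bullet> y" using P(2)[OF that] u2 by simp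
      with common_neighbours[OF n c(2) less_imp_le[OF this]] show ?thesis
        by (metis dist_0_norm mem_sphere)
    qed
    then show ?thesis using * False by blast
  qed
  have le: "u \<le> x \<bullet> y \<longleftrightarrow> (\<exists>r\<in>?S. \<exists>s\<in>?S. x = y \<or> r \<noteq> s \<and> ?N x y r s \<and> r \<bullet> s \<le> t)"
    if "x \<in> ?S" "y \<in> ?S" for x y
    by (rule main[OF that]) (use u1 cmp(1) in simp_all)
  have less: "u < x \<bullet> y \<longleftrightarrow> (\<exists>r\<in>?S. \<exists>s\<in>?S. x = y \<or> r \<noteq> s \<and> ?N x y r s \<and> r \<bullet> s < t)"
    if "x \<in> ?S" "y \<in> ?S" for x y
    by (rule main[OF that]) (use u1 cmp(2) in simp_all)
  have fi: "f x = f y \<longleftrightarrow> x = y" if "x \<in> ?S" "y \<in> ?S" for x y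
    using f that by (meson bij_betw_imp_inj_on inj_on_eq_iff)
  have fc: "f x \<bullet> f y = c \<longleftrightarrow> x \<bullet> y = c" if "x \<in> ?S" "y \<in> ?S" for x y
    using c(1) that unfolding preserves_eq_def by blast
  have ft: "f x \<bullet> f y \<le> t \<longleftrightarrow> x \<bullet> y \<le> t" "f x \<bullet> f y < t \<longleftrightarrow> x \<bullet> y < t"
    if "x \<in> ?S" "y \<in> ?S" for x y
    using t(1) that unfolding preserves_order_def by (metis not_less)+
  show ?thesis
    unfolding preserves_order_def u_def[symmetric]
  proof (intro ballI conjI)
    fix x y assume xy: "x \<in> ?S" "y \<in> ?S"
    show "u \<le> x \<bullet> y \<longleftrightarrow> u \<le> f x \<bullet> f y"
      by (rule definable_invariant[OF f xy le])
         (use xy in \<open>simp_all only: fc fi ft\<close>)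
    show "u < x \<bullet> y \<longleftrightarrow> u < f x \<bullet> f y"
      by (rule definable_invariant[OF f xy less])
         (use xy in \<open>simp_all only: fc fi ft\<close>)
  qed
qed

subsection \<open>Preserved angles\<close>

definition angle :: "real^3 \<Rightarrow> real^3 \<Rightarrow> real"
  where "angle x y = arccos (x \<bullet> y)"

lemma unit_inner_bounds:
  fixes x y :: "real^3"
  assumes "norm x = 1" "norm y = 1"
  shows "- 1 \<le> x \<bullet> y" "x \<bullet> y \<le> 1"
  using Cauchy_Schwarz_ineq2[of x y] assms by auto

lemma angle_bounds:
  assumes "norm x = 1" "norm y = 1"
  shows "0 \<le> angle x y" "angle x y \<le> pi" "cos (angle x y) = x \<bullet> y"
  using unit_inner_bounds[OF assms] by (auto simp: angle_def arccos_lbound arccos_ubound)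

lemma angle_commute: "angle x y = angle y x"
  by (simp add: angle_def inner_commute)

lemma angle_triangle:
  assumes "norm x = 1" "norm y = 1" "norm z = 1"
  shows "angle x z \<le> angle x y + angle y z"
proof (cases "angle x y + angle y z \<le> pi")
  case True
  define a b where "a = angle x y" and "b = angle y z"
  have ab: "0 \<le> a" "a \<le> pi" "0 \<le> b" "b \<le> pi" "cos a = x \<bullet> y" "cos b = y \<bullet> z"
    using angle_bounds assms by (auto simp: a_def b_def)
  have n: "x \<bullet> x = 1" "y \<bullet> y = 1" "z \<bullet> z = 1" using assms by (simp_all add: norm_eq_1)
  define u v where "u = x - (x \<bullet> y) *\<^sub>R y" and "v = z - (y \<bullet> z) *\<^sub>R y"
  have "u \<bullet> u = (sin a)\<^sup>2" "v \<bullet> v = (sin b)\<^sup>2" "u \<bullet> v = x \<bullet> z - cos a * cos b"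
    using n unfolding u_def v_def sin_squared_eq ab(5,6)
    by (simp_all add: inner_simps inner_commute power2_eq_square)
  then have "(x \<bullet> z - cos a * cos b)\<^sup>2 \<le> (sin a * sin b)\<^sup>2"
    using Cauchy_Schwarz_ineq[of u v] by (simp add: power_mult_distrib)
  then have "\<bar>x \<bullet> z - cos a * cos b\<bar> \<le> sin a * sin b"
    using ab by (simp add: abs_le_square_iff[symmetric] sin_ge_zero abs_mult)
  then have "cos (a + b) \<le> x \<bullet> z" by (simp add: cos_add)
  then have "cos (a + b) \<le> cos (angle x z)" using angle_bounds assms by simp
  then show ?thesis
    using True ab angle_bounds[of x z] assms
    unfolding a_def[symmetric] b_def[symmetric] by (subst (asm) cos_mono_le_eq) auto
next
  case False
  then show ?thesis using angle_bounds[of x z] assms by auto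
qed

lemma geodesic_point:
  assumes x: "norm x = 1" "norm y = 1" and s: "0 \<le> s" "s \<le> pi"
  obtains r where "norm r = 1" "angle x r = s" "angle y r = \<bar>s - angle x y\<bar>"
proof -
  define d where "d = angle x y"
  have d: "0 \<le> d" "d \<le> pi" "cos d = x \<bullet> y"
    using angle_bounds x by (auto simp: d_def)
  have xx: "x \<bullet> x = 1" "y \<bullet> y = 1" using x by (simp_all add: norm_eq_1)
  define u where "u = y - cos d *\<^sub>R x"
  have u: "u \<bullet> u = (sin d)\<^sup>2" "x \<bullet> u = 0"
    using xx unfolding u_def sin_squared_eq d(3)
    by (simp_all add: inner_simps inner_commute power2_eq_square)
  obtain n where n: "norm n = 1" "n \<bullet> x = 0" "y = cos d *\<^sub>R x + sin d *\<^sub>R n"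
  proof (cases "sin d = 0")
    case True
    then have "u = 0" using u by simp
    then show ?thesis using that ex_unit_normal[of x x] True by (auto simp: u_def)
  next
    case False
    then have "0 < sin d" using d sin_ge_zero[of d] by simp
    moreover have "norm u = sin d" using u calculation by (simp add: norm_eq_sqrt_inner)
    ultimately show ?thesis using u
      by (intro that[of "u /\<^sub>R sin d"]) (auto simp: u_def inner_commute)
  qed
  have nn: "n \<bullet> n = 1" using n(1) by (simp add: norm_eq_1)
  define r where "r = cos s *\<^sub>R x + sin s *\<^sub>R n"
  have xr: "x \<bullet> r = cos s" using n xx by (simp add: r_def inner_simps inner_commute)
  have "r \<bullet> r = 1"
    using n nn xx sin_cos_squared_add3[of s]
    by (simp add: r_def inner_simps inner_commute)
  moreover have "y \<bullet> r = cos \<bar>s - d\<bar>"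
    using n nn xx by (simp add: n(3) r_def inner_simps inner_commute cos_diff mult.commute)
  moreover have "\<bar>s - d\<bar> \<le> pi" using s d by auto
  ultimately have "norm r = 1" "angle x r = s" "angle y r = \<bar>s - d\<bar>"
    using s xr by (simp_all add: norm_eq_1 angle_def arccos_cos del: cos_abs_real)
  then show ?thesis using that unfolding d_def by blast
qed

lemma cos_le_inner_iff:
  assumes "norm x = 1" "norm y = 1" "0 \<le> a" "a \<le> pi"
  shows "cos a \<le> x \<bullet> y \<longleftrightarrow> angle x y \<le> a" "cos a < x \<bullet> y \<longleftrightarrow> angle x y < a"
  using angle_bounds(1,2)[OF assms(1,2)] assms(3,4)
  by (simp_all add: angle_bounds(3)[OF assms(1,2), symmetric] cos_mono_le_eq cos_mono_less_eq)

lemma preserves_order_cos_iff: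
  assumes f: "bij_betw f (sphere 0 1) (sphere 0 1)" and a: "0 \<le> a" "a \<le> pi"
  shows "preserves_order f (cos a) \<longleftrightarrow>
    (\<forall>x\<in>sphere 0 1. \<forall>y\<in>sphere 0 1.
      (angle (f x) (f y) \<le> a \<longleftrightarrow> angle x y \<le> a) \<and> (angle (f x) (f y) < a \<longleftrightarrow> angle x y < a))"
proof -
  have "norm (f x) = 1" if "x \<in> sphere 0 1" for x
    using f that bij_betwE by fastforce
  then show ?thesis
    unfolding preserves_order_def by (intro ball_cong refl) (auto simp: cos_le_inner_iff a)
qed

lemma preserves_order_add:
  assumes f: "bij_betw f (sphere 0 1) (sphere 0 1)" and ab: "0 < a" "0 < b" "a + b < pi"
    and "preserves_order f (cos a)" "preserves_order f (cos b)"
  shows "preserves_order f (cos (a + b))"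
proof -
  let ?S = "sphere (0::real^3) 1"
  have fa: "angle (f x) (f y) \<le> a \<longleftrightarrow> angle x y \<le> a" "angle (f x) (f y) < a \<longleftrightarrow> angle x y < a"
    and fb: "angle (f x) (f y) \<le> b \<longleftrightarrow> angle x y \<le> b" "angle (f x) (f y) < b \<longleftrightarrow> angle x y < b"
    if "x \<in> ?S" "y \<in> ?S" for x y
    using assms that by (auto simp: preserves_order_cos_iff[OF f])
  have le: "angle x y \<le> a + b \<longleftrightarrow> (\<exists>r\<in>?S. \<exists>s\<in>?S. angle x r \<le> a \<and> angle r y \<le> b)"
    if xy: "x \<in> ?S" "y \<in> ?S" for x y
  proof
    have n: "norm x = 1" "norm y = 1" using xy by auto
    assume D: "angle x y \<le> a + b"
    have "0 \<le> min a (angle x y)" "min a (angle x y) \<le> pi"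
      using ab angle_bounds[OF n] by auto
    then obtain r where r: "norm r = 1" "angle x r = min a (angle x y)"
        "angle y r = \<bar>min a (angle x y) - angle x y\<bar>"
      using geodesic_point[OF n] by blast
    then have "r \<in> ?S \<and> angle x r \<le> a \<and> angle r y \<le> b"
      using D ab by (auto simp: angle_commute[of r y])
    then show "\<exists>r\<in>?S. \<exists>s\<in>?S. angle x r \<le> a \<and> angle r y \<le> b" by blast
  next
    assume "\<exists>r\<in>?S. \<exists>s\<in>?S. angle x r \<le> a \<and> angle r y \<le> b"
    then obtain r where "r \<in> ?S" "angle x r \<le> a" "angle r y \<le> b" by blast
    then show "angle x y \<le> a + b" using angle_triangle[of x r y] xy by simp
  qed
  have less: "angle x y < a + b \<longleftrightarrow> (\<exists>r\<in>?S. \<exists>s\<in>?S. angle x r < a \<and> angle r y < b)"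
    if xy: "x \<in> ?S" "y \<in> ?S" for x y
  proof
    have n: "norm x = 1" "norm y = 1" using xy by auto
    assume D: "angle x y < a + b"
    define s where "s = (if angle x y < a then angle x y else (max 0 (angle x y - b) + a) / 2)"
    have s: "0 \<le> s" "s \<le> pi" "s < a" "s \<le> angle x y" "angle x y - s < b"
      using D ab angle_bounds[OF n] by (auto simp: s_def max_def field_simps)
    obtain r where "norm r = 1" "angle x r = s" "angle y r = \<bar>s - angle x y\<bar>"
      using geodesic_point[OF n s(1,2)] by blast
    then have "r \<in> ?S \<and> angle x r < a \<and> angle r y < b"
      using s by (auto simp: angle_commute[of r y])
    then show "\<exists>r\<in>?S. \<exists>s\<in>?S. angle x r < a \<and> angle r y < b" by blast
  next
    assume "\<exists>r\<in>?S. \<exists>s\<in>?S. angle x r < a \<and> angle r y < b"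
    then obtain r where "r \<in> ?S" "angle x r < a" "angle r y < b" by blast
    then show "angle x y < a + b" using angle_triangle[of x r y] xy by simp
  qed
  have ab': "0 \<le> a + b" "a + b \<le> pi" using ab by auto
  show ?thesis
    unfolding preserves_order_cos_iff[OF f ab']
  proof (intro ballI conjI)
    fix x y assume xy: "x \<in> ?S" "y \<in> ?S"
    have "angle x y \<le> a + b \<longleftrightarrow> angle (f x) (f y) \<le> a + b"
      by (rule definable_invariant[OF f xy le]) (use xy in \<open>simp_all only: fa fb\<close>)
    then show "angle (f x) (f y) \<le> a + b \<longleftrightarrow> angle x y \<le> a + b" ..
    have "angle x y < a + b \<longleftrightarrow> angle (f x) (f y) < a + b"
      by (rule definable_invariant[OF f xy less]) (use xy in \<open>simp_all only: fa fb\<close>)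
    then show "angle (f x) (f y) < a + b \<longleftrightarrow> angle x y < a + b" ..
  qed
qed

text \<open>For the difference, \<open>a - b < angle x y\<close> is expressed by walking from \<open>y\<close> away from \<open>x\<close>
  for a distance \<open>b\<close>; the walk may run into the antipode of \<open>x\<close>, whence the \<open>min pi\<close>.\<close>

lemma preserves_order_diff:
  assumes f: "bij_betw f (sphere 0 1) (sphere 0 1)" and ab: "0 < b" "b < a" "a < pi"
    and "preserves_order f (cos a)" "preserves_order f (cos b)"
  shows "preserves_order f (cos (a - b))"
proof -
  let ?S = "sphere (0::real^3) 1"
  have "0 \<le> a" "a \<le> pi" "0 \<le> b" "b \<le> pi" using ab by auto
  note iff = preserves_order_cos_iff[OF f this(1,2)] preserves_order_cos_iff[OF f this(3,4)]
  have fa: "a < angle (f x) (f y) \<longleftrightarrow> a < angle x y" "a \<le> angle (f x) (f y) \<longleftrightarrow> a \<le> angle x y"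
    and fb: "angle (f x) (f y) \<le> b \<longleftrightarrow> angle x y \<le> b"
    if "x \<in> ?S" "y \<in> ?S" for x y
    using assms(5,6) that unfolding iff by (meson not_less)+
  have gt: "a - b < angle x y \<longleftrightarrow> (\<exists>r\<in>?S. \<exists>s\<in>?S. a < angle x r \<and> angle r y \<le> b)"
    and ge: "a - b \<le> angle x y \<longleftrightarrow> (\<exists>r\<in>?S. \<exists>s\<in>?S. a \<le> angle x r \<and> angle r y \<le> b)"
    if xy: "x \<in> ?S" "y \<in> ?S" for x y
  proof -
    have n: "norm x = 1" "norm y = 1" using xy by auto
    have "0 \<le> min pi (angle x y + b)" "min pi (angle x y + b) \<le> pi"
      using ab angle_bounds[OF n] by auto
    then obtain r where "norm r = 1" "angle x r = min pi (angle x y + b)"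
        "angle y r = \<bar>min pi (angle x y + b) - angle x y\<bar>"
      using geodesic_point[OF n] by blast
    then have r: "r \<in> ?S" "angle x r = min pi (angle x y + b)" "angle r y \<le> b"
      using ab angle_bounds[OF n] by (auto simp: angle_commute[of r y])
    have tri: "angle x r \<le> angle x y + b" if "r \<in> ?S" "angle r y \<le> b" for r
      using angle_triangle[of x y r] that n by (auto simp: angle_commute[of y r])
    show "a - b < angle x y \<longleftrightarrow> (\<exists>r\<in>?S. \<exists>s\<in>?S. a < angle x r \<and> angle r y \<le> b)"
    proof
      assume "a - b < angle x y"
      with r ab have "a < angle x r" by auto
      with r show "\<exists>r\<in>?S. \<exists>s\<in>?S. a < angle x r \<and> angle r y \<le> b" by blast
    qed (use tri in fastforce)
    show "a - b \<le> angle x y \<longleftrightarrow> (\<exists>r\<in>?S. \<exists>s\<in>?S. a \<le> angle x r \<and> angle r y \<le> b)"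
    proof
      assume "a - b \<le> angle x y"
      with r ab have "a \<le> angle x r" by auto
      with r show "\<exists>r\<in>?S. \<exists>s\<in>?S. a \<le> angle x r \<and> angle r y \<le> b" by blast
    qed (use tri in fastforce)
  qed
  have ab': "0 \<le> a - b" "a - b \<le> pi" using ab by auto
  show ?thesis
    unfolding preserves_order_cos_iff[OF f ab']
  proof (intro ballI conjI)
    fix x y assume xy: "x \<in> ?S" "y \<in> ?S"
    have "a - b < angle x y \<longleftrightarrow> a - b < angle (f x) (f y)"
      by (rule definable_invariant[OF f xy gt]) (use xy in \<open>simp_all only: fa fb\<close>)
    then show "angle (f x) (f y) \<le> a - b \<longleftrightarrow> angle x y \<le> a - b" by (meson not_less)
    have "a - b \<le> angle x y \<longleftrightarrow> a - b \<le> angle (f x) (f y)"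
      by (rule definable_invariant[OF f xy ge]) (use xy in \<open>simp_all only: fa fb\<close>)
    then show "angle (f x) (f y) < a - b \<longleftrightarrow> angle x y < a - b" by (meson not_less)
  qed
qed

lemma preserves_order_multiple:
  assumes f: "bij_betw f (sphere 0 1) (sphere 0 1)"
    and a: "0 < a" "preserves_order f (cos a)" and "real (Suc n) * a < pi"
  shows "preserves_order f (cos (real (Suc n) * a))"
  using assms(4)
proof (induction n)
  case 0
  then show ?case using a by simp
next
  case (Suc n)
  have e: "real (Suc (Suc n)) * a = real (Suc n) * a + a" by (simp add: algebra_simps)
  have "preserves_order f (cos (real (Suc n) * a + a))"
    by (rule preserves_order_add[OF f]) (use Suc a e in \<open>auto simp del: of_nat_Suc\<close>)
  then show ?case unfolding e .
qed

lemma preserves_small_angles_imp_isometry: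
  assumes f: "bij_betw f (sphere 0 1) (sphere 0 1)"
    and small: "\<And>e. 0 < e \<Longrightarrow> \<exists>a. 0 < a \<and> a < e \<and> preserves_order f (cos a)"
    and xy: "x \<in> sphere 0 1" "y \<in> sphere 0 1"
  shows "f x \<bullet> f y = x \<bullet> y"
proof -
  have fxy: "norm (f x) = 1" "norm (f y) = 1" "norm x = 1" "norm y = 1"
    using f xy bij_betwE[OF f] by auto
  have sep: "\<exists>t. d < t \<and> t \<le> d' \<and> 0 \<le> t \<and> t \<le> pi \<and> preserves_order f (cos t)"
    if d: "0 \<le> d" "d < d'" "d' \<le> pi" for d d'
  proof -
    obtain a where a: "0 < a" "a < d' - d" "preserves_order f (cos a)"
      using small[of "d' - d"] d by auto
    define n where "n = nat \<lfloor>d / a\<rfloor>"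
    have n: "real n \<le> d / a" "d / a < real n + 1"
      using d a by (simp_all add: n_def floor_correct)
    then have "real n * a \<le> d" "d < (real n + 1) * a" using a by (simp_all add: field_simps)
    then have t: "d < real (Suc n) * a" "real (Suc n) * a < d'"
      using a by (simp_all add: algebra_simps)
    with d have "preserves_order f (cos (real (Suc n) * a))"
      by (intro preserves_order_multiple[OF f a(1,3)]) simp
    with t d show ?thesis by (intro exI[of _ "real (Suc n) * a"]) auto
  qed
  have "angle (f x) (f y) = angle x y"
  proof (rule linorder_cases[of "angle (f x) (f y)" "angle x y"])
    assume "angle (f x) (f y) < angle x y"
    from sep[OF angle_bounds(1)[OF fxy(1,2)] this angle_bounds(2)[OF fxy(3,4)]]
    obtain t where t: "angle (f x) (f y) < t" "t \<le> angle x y" "0 \<le> t" "t \<le> pi"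
      "preserves_order f (cos t)" by blast
    then have "angle x y < t"
      using xy unfolding preserves_order_cos_iff[OF f t(3,4)] by blast
    with t show ?thesis by simp
  next
    assume "angle x y < angle (f x) (f y)"
    from sep[OF angle_bounds(1)[OF fxy(3,4)] this angle_bounds(2)[OF fxy(1,2)]]
    obtain t where t: "angle x y < t" "t \<le> angle (f x) (f y)" "0 \<le> t" "t \<le> pi"
      "preserves_order f (cos t)" by blast
    then have "angle (f x) (f y) < t"
      using xy unfolding preserves_order_cos_iff[OF f t(3,4)] by blast
    with t show ?thesis by simp
  qed
  then show ?thesis
    using angle_bounds(3)[OF fxy(1,2)] angle_bounds(3)[OF fxy(3,4)] by simp
qed

subsection \<open>Isometry or preservation of orthogonality\<close>

lemma unit_third_vector:
  fixes x y z :: "'a::real_inner"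
  assumes "norm x = 1" "norm y = 1" "norm z = 1"
    and "x \<bullet> y = - 1 / 2" "x \<bullet> z = - 1 / 2" "y \<bullet> z = - 1 / 2"
  shows "z = - (x + y)"
proof -
  have "(x + y + z) \<bullet> (x + y + z) = 0"
    using assms by (simp add: norm_eq_1 inner_simps inner_commute)
  then show ?thesis by (simp add: eq_neg_iff_add_eq_0 add.commute del: minus_add_distrib)
qed

text \<open>The nine points are images of roots of \<open>A\<^sub>3\<close>, rescaled to unit vectors. In the image, every
  triple with inner products \<open>- 1 / 2\<close> still sums to zero, and the three 4-cycles
  \<open>p, r, q, s\<close>, \<open>x1, p, x3, - q\<close> and \<open>x1, r, x2, - s\<close> force \<open>f p \<bullet> f q = f r \<bullet> f s\<close>,
  hence \<open>f p \<bullet> f q = 0\<close>.\<close>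

lemma preserves_orthogonal_of_preserves_half:
  fixes f :: "real^3 \<Rightarrow> real^3"
  assumes unit: "\<And>x. norm x = 1 \<Longrightarrow> norm (f x) = 1"
    and inj: "inj_on f (sphere 0 1)"
    and pres: "\<And>x y. norm x = 1 \<Longrightarrow> norm y = 1 \<Longrightarrow> x \<bullet> y = - 1 / 2 \<Longrightarrow> f x \<bullet> f y = - 1 / 2"
    and pq: "norm p = 1" "norm q = 1" "p \<bullet> q = 0"
  shows "f p \<bullet> f q = 0"
proof -
  obtain n where n: "norm n = 1" "n \<bullet> p = 0" "n \<bullet> q = 0" using ex_unit_normal by blast
  define r s where "r = - (1 / 2) *\<^sub>R (p + q) + (sqrt 2 / 2) *\<^sub>R n"
    and "s = - (1 / 2) *\<^sub>R (p + q) - (sqrt 2 / 2) *\<^sub>R n"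
  define x1 x2 x3 where "x1 = - (p + r)" and "x2 = - (q + r)" and "x3 = - (p + s)"
  have n1: "p \<bullet> p = 1" "q \<bullet> q = 1" "n \<bullet> n = 1" using n pq by (simp_all add: norm_eq_1)
  note [simp] = n1 pq(3) n(2,3) inner_commute[of q p] inner_commute[of p n] inner_commute[of q n]
  have in1: "p \<bullet> r = - 1 / 2" "p \<bullet> s = - 1 / 2" "q \<bullet> r = - 1 / 2" "q \<bullet> s = - 1 / 2"
    "r \<bullet> s = 0" "r \<bullet> r = 1" "s \<bullet> s = 1"
    unfolding r_def s_def by (simp_all add: inner_simps)
  note [simp] = in1 inner_commute[of r p] inner_commute[of s p] inner_commute[of r q]
    inner_commute[of s q] inner_commute[of s r]
  have norms: "norm p = 1" "norm q = 1" "norm r = 1" "norm s = 1" "norm x1 = 1" "norm x2 = 1"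
    "norm x3 = 1" "norm (- q) = 1" "norm (- s) = 1"
    using pq by (simp_all add: norm_eq_1 x1_def x2_def x3_def inner_simps)
  note unit' = norms[THEN unit]
  have edges: "p \<bullet> r = - 1 / 2" "p \<bullet> s = - 1 / 2" "q \<bullet> r = - 1 / 2" "q \<bullet> s = - 1 / 2"
    "x1 \<bullet> p = - 1 / 2" "x1 \<bullet> r = - 1 / 2" "x2 \<bullet> q = - 1 / 2" "x2 \<bullet> r = - 1 / 2"
    "x3 \<bullet> p = - 1 / 2" "x3 \<bullet> s = - 1 / 2" "x1 \<bullet> - q = - 1 / 2" "x1 \<bullet> - s = - 1 / 2"
    "x3 \<bullet> - q = - 1 / 2" "x2 \<bullet> - s = - 1 / 2" "- q \<bullet> - s = - 1 / 2"
    by (simp_all add: x1_def x2_def x3_def inner_simps)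
  have e: "f p \<bullet> f r = - 1 / 2" "f p \<bullet> f s = - 1 / 2" "f q \<bullet> f r = - 1 / 2" "f q \<bullet> f s = - 1 / 2"
    "f x1 \<bullet> f p = - 1 / 2" "f x1 \<bullet> f r = - 1 / 2" "f x2 \<bullet> f q = - 1 / 2" "f x2 \<bullet> f r = - 1 / 2"
    "f x3 \<bullet> f p = - 1 / 2" "f x3 \<bullet> f s = - 1 / 2" "f x1 \<bullet> f (- q) = - 1 / 2" "f x1 \<bullet> f (- s) = - 1 / 2"
    "f x3 \<bullet> f (- q) = - 1 / 2" "f x2 \<bullet> f (- s) = - 1 / 2" "f (- q) \<bullet> f (- s) = - 1 / 2"
    by (intro pres norms edges)+
  have neq: "f a \<noteq> f b" if "norm a = 1" "norm b = 1" "a \<bullet> b \<noteq> 1" for a b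
    using inj that by (metis dist_0_norm inj_onD mem_sphere norm_eq_1)
  have neqs: "f p \<noteq> f q" "f r \<noteq> f s" "f p \<noteq> f (- q)" "f r \<noteq> f (- s)" "f x1 \<noteq> f x2" "f x1 \<noteq> f x3"
    by (rule neq; use norms in \<open>simp_all add: x1_def x2_def x3_def inner_simps\<close>)+
  define k k' where "k = f p \<bullet> f q" and "k' = f r \<bullet> f s"
  have third: "f x1 = - (f p + f r)" "f x2 = - (f q + f r)" "f x3 = - (f p + f s)"
    by (rule unit_third_vector; use e unit' in \<open>simp add: inner_commute\<close>)+
  have "f x1 = - (f (- q) + f (- s))"
    by (rule unit_third_vector; use e unit' in \<open>simp add: inner_commute\<close>)
  with third(1) have fourth: "f (- q) + f (- s) = f p + f r" by (metis neg_equal_iff_equal)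
  have f1: "f p \<bullet> f p = 1" "f q \<bullet> f q = 1" "f r \<bullet> f r = 1" "f s \<bullet> f s = 1"
    "f (- q) \<bullet> f (- q) = 1" "f (- s) \<bullet> f (- s) = 1"
    using unit' by (simp_all add: norm_eq_1)
  have c1: "(1 + k) * (1 + k') = 1"
    unfolding k_def k'_def
    using four_cycle[of "f p" "f q" "f r" "f s" "- 1 / 2"] e unit' neqs by (simp add: power2_eq_square)
  have x13: "f x1 \<bullet> f x3 = k'" and x12: "f x1 \<bullet> f x2 = k"
    using e(1-4) f1 by (simp_all add: third k_def k'_def inner_simps inner_commute)
  have c2: "(1 + k') * (1 + f p \<bullet> f (- q)) = 1"
    using four_cycle[of "f x1" "f x3" "f p" "f (- q)" "- 1 / 2"] e unit' neqs
    by (simp add: power2_eq_square x13)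
  have c3: "(1 + k) * (1 + f r \<bullet> f (- s)) = 1"
    using four_cycle[of "f x1" "f x2" "f r" "f (- s)" "- 1 / 2"] e unit' neqs
    by (simp add: power2_eq_square x12)
  have "1 + k \<noteq> 0" "1 + k' \<noteq> 0" using c1 by auto
  have y: "f p \<bullet> f (- q) = k"
    using c1 c2 \<open>1 + k' \<noteq> 0\<close> by (metis add_left_cancel mult.commute mult_left_cancel)
  have z: "f r \<bullet> f (- s) = k'"
    using c1 c3 \<open>1 + k \<noteq> 0\<close> by (metis add_left_cancel mult_left_cancel)
  have "f p \<bullet> (f (- q) + f (- s)) = f p \<bullet> (f p + f r)"
    "f (- s) \<bullet> (f (- q) + f (- s)) = f (- s) \<bullet> (f p + f r)"
    by (simp_all only: fourth)
  then have "k = k'"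
    using e(1,15) f1 y z by (simp add: inner_add_right inner_commute)
  then have "(1 + k)\<^sup>2 = 1" using c1 by (simp add: power2_eq_square)
  then have "k = 0 \<or> k = - 2" by (auto simp: power2_eq_1_iff)
  moreover have "- 1 \<le> k" using unit_inner_bounds[of "f p" "f q"] unit' by (simp add: k_def)
  ultimately show ?thesis by (simp add: k_def)
qed

lemma preserves_eq_0_of_preserves_half:
  assumes f: "bij_betw f (sphere 0 1) (sphere 0 1)" and "preserves_eq f (- 1 / 2)"
  shows "preserves_eq f 0"
proof -
  let ?S = "sphere (0::real^3) 1"
  define g where "g = inv_into ?S f"
  have g: "bij_betw g ?S ?S" unfolding g_def by (rule bij_betw_inv_into[OF f])
  have fg: "f (g x) = x" "g (f x) = x" if "x \<in> ?S" for x
    using f that by (auto simp: g_def bij_betw_inv_into_right bij_betw_inv_into_left)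
  have S: "f x \<in> ?S" "g x \<in> ?S" if "x \<in> ?S" for x
    using f g that by (meson bij_betwE)+
  have half: "x \<bullet> y = - 1 / 2 \<longleftrightarrow> f x \<bullet> f y = - 1 / 2" if "x \<in> ?S" "y \<in> ?S" for x y
    using assms(2) that unfolding preserves_eq_def by blast
  have "f x \<bullet> f y = 0" if "x \<in> ?S" "y \<in> ?S" "x \<bullet> y = 0" for x y
  proof (rule preserves_orthogonal_of_preserves_half[where f = f])
    show "norm (f x) = 1" if "norm x = 1" for x using S(1)[of x] that by simp
    show "f x \<bullet> f y = - 1 / 2" if "norm x = 1" "norm y = 1" "x \<bullet> y = - 1 / 2" for x y
      using half[of x y] that unfolding mem_sphere dist_0_norm by blast
  qed (use that bij_betw_imp_inj_on[OF f] in simp_all)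
  moreover have "g x \<bullet> g y = 0" if "x \<in> ?S" "y \<in> ?S" "x \<bullet> y = 0" for x y
  proof (rule preserves_orthogonal_of_preserves_half[where f = g])
    show "norm (g x) = 1" if "norm x = 1" for x using S(2)[of x] that by simp
    show "g x \<bullet> g y = - 1 / 2" if "norm x = 1" "norm y = 1" "x \<bullet> y = - 1 / 2" for x y
    proof -
      have "x \<in> ?S" "y \<in> ?S" using that by auto
      with half[OF S(2) S(2)] that(3) show ?thesis by (simp only: fg)
    qed
  qed (use that bij_betw_imp_inj_on[OF g] in simp_all)
  ultimately have "x \<bullet> y = 0 \<longleftrightarrow> f x \<bullet> f y = 0" if "x \<in> ?S" "y \<in> ?S" for x y
    using that fg(2) S(1) by (metis (no_types))
  then show ?thesis unfolding preserves_eq_def by blast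
qed

text \<open>If the preserved angles are not arbitrarily small, closure under differences yields a
  smallest one, \<open>m\<close>, and no preserved angle lies strictly between \<open>m\<close> and \<open>2 * m\<close>. The rhombus of
  two equilateral triangles of side \<open>m\<close> (if \<open>m < pi / 2\<close>) or the angle \<open>2 * pi - 2 * m\<close> contradicts
  this, except for \<open>m = pi / 2\<close> and \<open>m = 2 * pi / 3\<close>, where orthogonality is preserved.\<close>

lemma preserves_eq_dichotomy:
  assumes f: "bij_betw f (sphere 0 1) (sphere 0 1)" and c: "preserves_eq f c" "c \<noteq> 0" "c\<^sup>2 < 1"
  shows "(\<forall>x\<in>sphere 0 1. \<forall>y\<in>sphere 0 1. f x \<bullet> f y = x \<bullet> y) \<or> 2 * c\<^sup>2 \<le> 1 \<and> preserves_eq f 0"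
proof (rule ccontr)
  assume neg: "\<not> ?thesis"
  define A where "A = {a. 0 < a \<and> a < pi \<and> preserves_order f (cos a)}"
  have mem: "arccos t \<in> A" if "preserves_order f t" "- 1 < t" "t < 1" for t
    using that arccos_lt_bounded[of t] by (auto simp: A_def)
  have c2: "0 < c\<^sup>2" using c(2) by simp
  have cA: "arccos (2 * c\<^sup>2 - 1) \<in> A"
    by (rule mem) (use preserves_order_double[OF f c] c(3) c2 in auto)
  obtain e where e: "0 < e" "\<And>a. a \<in> A \<Longrightarrow> e \<le> a"
  proof -
    have "\<exists>e>0. \<forall>a\<in>A. e \<le> a"
    proof (rule ccontr)
      assume *: "\<not> (\<exists>e>0. \<forall>a\<in>A. e \<le> a)"
      have "\<exists>a. 0 < a \<and> a < e \<and> preserves_order f (cos a)" if "0 < e" for e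
        using * that unfolding A_def by (smt (verit) mem_Collect_eq)
      then have "\<forall>x\<in>sphere 0 1. \<forall>y\<in>sphere 0 1. f x \<bullet> f y = x \<bullet> y"
        using preserves_small_angles_imp_isometry[OF f] by blast
      with neg show False by blast
    qed
    then show ?thesis using that by blast
  qed
  have diff: "a - b \<in> A" if "a \<in> A" "b \<in> A" "b < a" for a b
    using that preserves_order_diff[OF f, of b a] by (auto simp: A_def)
  have bdd: "bdd_below A" using e by (meson bdd_below.I)
  have "Inf A < Inf A + e" using e by simp
  then obtain m where m: "m \<in> A" "m < Inf A + e"
    using cA cInf_lessD[of A "Inf A + e"] by blast
  have min: "m \<le> a" if "a \<in> A" for a
  proof (rule ccontr)
    assume "\<not> m \<le> a"
    then have "m - a \<in> A" using diff m that by simp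
    then have "e \<le> m - a" using e by blast
    moreover have "Inf A \<le> a" by (rule cInf_lower[OF that bdd])
    ultimately show False using m by simp
  qed
  have gap: False if "a \<in> A" "m < a" "a < 2 * m" for a
    using min[OF diff[OF that(1) m(1) that(2)]] that by simp
  have m': "0 < m" "m < pi" "preserves_order f (cos m)" using m by (auto simp: A_def)
  have cos2m: "cos (2 * m) = 2 * (cos m)\<^sup>2 - 1" by (rule cos_double_cos)
  have cm1: "(cos m)\<^sup>2 < 1"
    using sin_squared_eq[of m] sin_gt_zero[of m] m' zero_less_power2[of "sin m"] by simp
  consider "m < pi / 2" | "m = pi / 2" | "pi / 2 < m" by linarith
  then have "preserves_eq f 0 \<and> pi / 2 \<le> m"
  proof cases
    case 1
    define k where "k = cos m"
    have k: "0 < k" "k < 1" "preserves_order f k"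
      using 1 m' cos_gt_zero_pi[of m] cos_monotone_0_pi[of 0 m] by (auto simp: k_def)
    define t where "t = 4 * k\<^sup>2 / (1 + k) - 1"
    have "k\<^sup>2 < k" using k by (simp add: power2_eq_square)
    then have t: "preserves_order f t"
      unfolding t_def using k
      by (intro preserves_order_rhombus[OF f] preserves_order_imp_eq) auto
    have "t < k" "2 * k\<^sup>2 - 1 < t"
    proof -
      have "0 < (1 - k) * (1 + 3 * k)" using k by (intro mult_pos_pos) auto
      then have "4 * k\<^sup>2 < (1 + k) * (1 + k)" by (simp add: power2_eq_square algebra_simps)
      then show "t < k" using k by (simp add: t_def field_simps)
      have "2 * k\<^sup>2 * (1 + k) < 4 * k\<^sup>2" using k by simp
      then show "2 * k\<^sup>2 - 1 < t" using k by (simp add: t_def pos_less_divide_eq)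
    qed
    moreover have "0 \<le> k\<^sup>2" by simp
    ultimately have t1: "-1 < t" "t < 1" using k by linarith+
    have "arccos t \<in> A" by (rule mem[OF t t1])
    moreover have "m < arccos t"
      using arccos_less_mono[of k t] \<open>t < k\<close> t1 k arccos_cos[of m] m' by (simp add: k_def)
    moreover have "arccos t < 2 * m"
      using arccos_less_mono[of t "cos (2 * m)"] \<open>2 * k\<^sup>2 - 1 < t\<close> t1 1 m' arccos_cos[of "2 * m"] cos2m
        abs_cos_le_one[of "2 * m"]
      by (simp add: k_def)
    ultimately show ?thesis using gap by blast
  next
    case 2
    then show ?thesis using preserves_order_imp_eq[OF m'(3)] unfolding 2 by simp
  next
    case 3
    have "cos m < 0" using 3 m' cos_monotone_0_pi[of "pi / 2" m] by simp
    then have "preserves_order f (cos (2 * m))"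
      unfolding cos2m
      by (intro preserves_order_double[OF f] preserves_order_imp_eq m' cm1) auto
    moreover have "cos (2 * pi - 2 * m) = cos (2 * m)" by (simp add: cos_diff)
    ultimately have "preserves_order f (cos (2 * pi - 2 * m))" by (simp only:)
    then have "2 * pi - 2 * m \<in> A" using 3 m' by (simp add: A_def)
    then have "m \<le> 2 * pi - 2 * m" "\<not> m < 2 * pi - 2 * m"
      using min gap[of "2 * pi - 2 * m"] 3 by auto
    then have "m = pi - pi / 3" by simp
    then have "cos m = cos (pi - pi / 3)" by (simp only:)
    also have "\<dots> = - 1 / 2" unfolding cos_diff by (simp add: cos_60)
    finally have "cos m = - 1 / 2" .
    then show ?thesis
      using preserves_eq_0_of_preserves_half[OF f] preserves_order_imp_eq[OF m'(3)] 3 by simp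
  qed
  moreover have "2 * c\<^sup>2 \<le> 1"
  proof -
    have "pi / 2 \<le> arccos (2 * c\<^sup>2 - 1)" using min[OF cA] calculation by simp
    then have "cos (arccos (2 * c\<^sup>2 - 1)) \<le> cos (pi / 2)"
      using c(3) c2 by (intro cos_monotone_0_pi_le) (auto intro: arccos_ubound)
    then show ?thesis using c(3) c2 by simp
  qed
  ultimately show False using neg by blast
qed

subsection \<open>Maps preserving orthogonality\<close>

lemma real_ring_endomorphism_id:
  fixes F :: "real \<Rightarrow> real"
  assumes add: "\<And>x y. F (x + y) = F x + F y" and mult: "\<And>x y. F (x * y) = F x * F y"
    and one: "F 1 = 1"
  shows "F x = x"
proof -
  have zero: "F 0 = 0" using add[of 0 0] by simp
  have minus: "F (- x) = - F x" for x using add[of x "- x"] zero by simp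
  have nat: "F (real n) = real n" for n
    by (induction n) (simp_all add: zero add one)
  have rat: "F q = q" if "q \<in> \<rat>" for q
  proof -
    from that obtain a b where b: "0 < b" and q: "q = of_int a / of_int b"
      by (meson Rats_cases')
    have int: "F (of_int k) = of_int k" for k
      by (cases k rule: int_cases2) (simp_all add: nat minus)
    have "F q * of_int b = F (q * of_int b)" by (simp add: mult int)
    also have "\<dots> = of_int a" using b by (simp add: q int)
    finally show ?thesis using b by (simp add: q field_simps)
  qed
  have mono: "F x \<le> F y" if "x \<le> y" for x y
  proof -
    have "sqrt (y - x) * sqrt (y - x) = y - x" using that by simp
    then have "F y = F (x + sqrt (y - x) * sqrt (y - x))" by simp
    also have "\<dots> = F x + F (sqrt (y - x)) * F (sqrt (y - x))" by (simp only: add mult)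
    finally show ?thesis by simp
  qed
  show ?thesis
  proof (rule linorder_cases[of "F x" x])
    assume "F x < x"
    then obtain q where "q \<in> \<rat>" "F x < q" "q < x" using Rats_dense_in_real by blast
    then show ?thesis using mono[of q x] rat[of q] by simp
  next
    assume "x < F x"
    then obtain q where "q \<in> \<rat>" "x < q" "q < F x" using Rats_dense_in_real by blast
    then show ?thesis using mono[of x q] rat[of q] by simp
  qed
qed

text \<open>The three-dimensional real case of the fundamental theorem of projective geometry: the
  maps \<open>g i j\<close> below describe the induced action on the coordinate lines, and preservation
  of \<open>1 + a * c + b * d = 0\<close> makes them a ring endomorphism of the reals up to sign.\<close>

lemma orthogonality_preserving_coordinates:
  fixes F :: "real^3 \<Rightarrow> real^3"
  assumes nz: "\<And>v. v \<noteq> 0 \<Longrightarrow> F v \<noteq> 0"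
    and orth: "\<And>v w. v \<noteq> 0 \<Longrightarrow> w \<noteq> 0 \<Longrightarrow> v \<bullet> w = 0 \<longleftrightarrow> F v \<bullet> F w = 0"
    and ax: "\<And>i j. i \<noteq> j \<Longrightarrow> F (axis i 1) $ j = 0"
  obtains s t where "s\<^sup>2 = 1" "t\<^sup>2 = 1"
    "\<And>v. v \<noteq> 0 \<Longrightarrow> \<exists>c. F v = c *\<^sub>R vector [v $ 1, s * v $ 2, t * v $ 3]"
proof -
  have zero: "F v $ i = 0 \<longleftrightarrow> v $ i = 0" if "v \<noteq> 0" for v i
  proof -
    have a: "axis i 1 \<noteq> (0::real^3)" by (simp add: axis_eq_0_iff)
    have e: "F (axis i 1) = axis i (F (axis i 1) $ i)"
      using ax[of i] by (auto simp: vec_eq_iff axis_def)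
    have "F (axis i 1) $ i \<noteq> 0" using nz[OF a] e by (metis axis_eq_0_iff)
    moreover have "F v \<bullet> F (axis i 1) = F v $ i * F (axis i 1) $ i"
      by (subst e) (simp add: inner_axis)
    ultimately show ?thesis using orth[OF that a] by (simp add: inner_axis)
  qed
  have ratio: "F v $ j * F w $ i = F w $ j * F v $ i"
    if "i \<noteq> j" "v $ i \<noteq> 0" "w $ i \<noteq> 0" "v $ i * w $ j = v $ j * w $ i" for v w i j
  proof -
    define u :: "real^3" where "u = (\<chi> m. if m = i then - v $ j else if m = j then v $ i else 0)"
    have u: "u $ i = - v $ j" "u $ j = v $ i" "\<And>m. m \<noteq> i \<Longrightarrow> m \<noteq> j \<Longrightarrow> u $ m = 0"
      using that(1) by (auto simp: u_def)
    have u0: "u \<noteq> 0" using u(2) that(2) by auto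
    have dot: "x \<bullet> y = x $ i * y $ i + x $ j * y $ j"
      if "\<And>m. m \<noteq> i \<Longrightarrow> m \<noteq> j \<Longrightarrow> y $ m = 0" for x y :: "real^3"
    proof -
      have "x \<bullet> y = (\<Sum>m\<in>{i, j}. x $ m * y $ m)"
        unfolding inner_vec_def by (rule sum.mono_neutral_cong_right) (use that in auto)
      then show ?thesis using \<open>i \<noteq> j\<close> by simp
    qed
    have Fu: "\<And>m. m \<noteq> i \<Longrightarrow> m \<noteq> j \<Longrightarrow> F u $ m = 0" "F u $ j \<noteq> 0"
      using u zero[OF u0] that(2) by auto
    have "v \<noteq> 0" "w \<noteq> 0" using that by auto
    then have "F v \<bullet> F u = 0" "F w \<bullet> F u = 0"
      using that u0 dot[OF u(3)] u orth[of v u] orth[of w u] by (auto simp: mult.commute)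
    then have "F v $ i * F u $ i + F v $ j * F u $ j = 0" "F w $ i * F u $ i + F w $ j * F u $ j = 0"
      using dot[OF Fu(1)] by simp_all
    then have "(F v $ j * F w $ i - F w $ j * F v $ i) * F u $ j = 0" by algebra
    then show ?thesis using Fu(2) by simp
  qed
  define g where "g i j t = F (axis i 1 + t *\<^sub>R axis j 1) $ j / F (axis i 1 + t *\<^sub>R axis j 1) $ i"
    for i j :: 3 and t
  have g: "F v $ j = g i j (v $ j / v $ i) * F v $ i" if "i \<noteq> j" "v $ i \<noteq> 0" for v i j
  proof -
    define w :: "real^3" where "w = axis i 1 + (v $ j / v $ i) *\<^sub>R axis j 1"
    have w: "w $ i = 1" "w $ j = v $ j / v $ i" using that(1) by (simp_all add: w_def axis_def)
    then have "w \<noteq> 0" by auto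
    then have "F w $ i \<noteq> 0" using zero[of w i] w by simp
    then show ?thesis
      using ratio[of i j v w] that w by (simp add: g_def w_def[symmetric] field_simps)
  qed
  let ?V = "\<lambda>a b. vector [1, a, b] :: real^3"
  have V: "?V a b \<noteq> 0" for a b by (auto simp: vec_eq_iff forall_3)
  have V1: "F (?V a b) $ 1 \<noteq> 0" for a b using zero[OF V] by simp
  have V2: "F (?V a b) $ 2 = g 1 2 a * F (?V a b) $ 1" "F (?V a b) $ 3 = g 1 3 b * F (?V a b) $ 1" for a b
    using g[of 1 2 "?V a b"] g[of 1 3 "?V a b"] by simp_all
  have V3: "g 1 3 b = g 2 3 (b / a) * g 1 2 a" if "a \<noteq> 0" for a b
    using g[of 2 3 "?V a b"] that V1[of a b] by (simp add: V2)
  have O: "1 + a * c + b * d = 0 \<longleftrightarrow> 1 + g 1 2 a * g 1 2 c + g 1 3 b * g 1 3 d = 0" for a b c d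
  proof -
    have "F (?V a b) \<bullet> F (?V c d) =
        (1 + g 1 2 a * g 1 2 c + g 1 3 b * g 1 3 d) * (F (?V a b) $ 1 * F (?V c d) $ 1)"
      by (simp add: inner_vec_def sum_3 V2 algebra_simps)
    moreover have "?V a b \<bullet> ?V c d = 1 + a * c + b * d" by (simp add: inner_vec_def sum_3)
    ultimately show ?thesis using orth[OF V V, of a b c d] V1 by simp
  qed
  have g0: "g 1 2 0 = 0" "g 1 3 0 = 0"
    using V2[of 0 0] zero[OF V, of 0 0 2] zero[OF V, of 0 0 3] V1[of 0 0] by simp_all
  have f1: "g 1 2 1 * g 1 2 (- 1) = - 1" and g1: "g 1 3 1 * g 1 3 (- 1) = - 1"
    using O[of 1 "- 1" 0 0] O[of 0 0 1 "- 1"] g0 by simp_all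
  define k where "k = g 1 2 1"
  define l where "l = g 2 3 1"
  have k0: "k \<noteq> 0" using f1 by (auto simp: k_def)
  have g3: "g 1 3 a = l * g 1 2 a" for a
    using V3[of a a] g0 by (cases "a = 0") (simp_all add: l_def)
  have l0: "l \<noteq> 0" using g1 g3[of 1] by auto
  define E where "E x = g 1 2 x / k" for x
  have E1: "E 1 = 1" "E 0 = 0" using k0 g0 by (simp_all add: E_def k_def)
  have h: "g 2 3 b = l * E b" for b
    using V3[of 1 b] g3[of b] k0 by (simp add: E_def k_def field_simps)
  have Emult: "E (x * y) = E x * E y" for x y
  proof (cases "y = 0")
    case False
    then have "l * g 1 2 (x * y) = l * E x * g 1 2 y"
      using V3[of y "x * y"] by (simp add: g3 h)
    then show ?thesis using l0 k0 by (simp add: E_def field_simps)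
  qed (simp add: E1)
  have "E (- 1) * E (- 1) = 1" using Emult[of "- 1" "- 1"] E1 by simp
  moreover have kE: "k * k * E (- 1) = - 1" using f1 k0 by (simp add: E_def k_def)
  moreover have "0 < k * k" using k0 by (simp add: zero_less_mult_iff) linarith
  ultimately have Em: "E (- 1) = - 1"
    by (metis mult_minus_right mult_1_right neg_equal_iff_equal power2_eq_1_iff power2_eq_square zero_less_mult_iff less_minus_one_simps(1) not_less_iff_gr_or_eq)
  then have k2: "k\<^sup>2 = 1" using kE by (simp add: power2_eq_square)
  have "(l * k) * (l * g 1 2 (- 1)) = - 1" using g1 by (simp add: g3 k_def)
  then have l2: "l\<^sup>2 = 1" using f1 by (simp add: k_def power2_eq_square algebra_simps)
  have Eneg: "E (- x) = - E x" for x using Emult[of "- 1" x] Em by simp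
  have O': "1 + E c + E d = 0" if "1 + c + d = 0" for c d
  proof -
    have "1 + k * g 1 2 c + l * k * (l * g 1 2 d) = 0"
      using O[of 1 c 1 d] that by (simp add: g3 k_def)
    then have "1 + k\<^sup>2 * E c + l\<^sup>2 * (k\<^sup>2 * E d) = 0"
      using k0 by (simp add: E_def power2_eq_square algebra_simps)
    then show ?thesis by (simp add: k2 l2)
  qed
  have Eadd: "E (x + y) = E x + E y" for x y
  proof (cases "y = 0")
    case False
    have "1 + E (x / y) = E (1 + x / y)" using O'[of "x / y" "- (1 + x / y)"] Eneg[of "1 + x / y"] by simp
    then have "(1 + E (x / y)) * E y = E ((1 + x / y) * y)" by (simp add: Emult)
    moreover have "E (x / y) * E y = E x" using False by (simp flip: Emult)
    moreover have "(1 + x / y) * y = x + y" using False by (simp add: field_simps)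
    ultimately show ?thesis by (simp only: distrib_right mult_1_left add.commute)
  qed (simp add: E1)
  have E: "E x = x" for x by (rule real_ring_endomorphism_id) (rule Eadd Emult E1(1))+
  have G: "g 1 2 x = k * x" "g 1 3 x = l * k * x" "g 2 3 x = l * x" for x
    using E[of x] k0 h[of x] g3[of x] by (auto simp: E_def field_simps)
  show ?thesis
  proof (rule that[of k "l * k"])
    show "k\<^sup>2 = 1" "(l * k)\<^sup>2 = 1" using k2 l2 by (simp_all add: power_mult_distrib)
    fix v :: "real^3" assume v: "v \<noteq> 0"
    have k': "k * k = 1" using k2 by (simp add: power2_eq_square)
    consider "v $ 1 \<noteq> 0" | "v $ 1 = 0" "v $ 2 \<noteq> 0" | "v $ 1 = 0" "v $ 2 = 0" by blast
    then show "\<exists>c. F v = c *\<^sub>R vector [v $ 1, k * v $ 2, l * k * v $ 3]"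
    proof cases
      case 1
      then show ?thesis using g[of 1 2 v] g[of 1 3 v]
        by (intro exI[of _ "F v $ 1 / v $ 1"]) (simp add: vec_eq_iff forall_3 G)
    next
      case 2
      then have "F v $ 1 = 0" using zero[OF v] by simp
      then show ?thesis using g[of 2 3 v] 2 k' k0
        by (intro exI[of _ "F v $ 2 / (k * v $ 2)"]) (simp add: vec_eq_iff forall_3 G)
    next
      case 3
      then have "F v $ 1 = 0" "F v $ 2 = 0" "v $ 3 \<noteq> 0"
        using zero[OF v] v by (auto simp: vec_eq_iff forall_3)
      then show ?thesis using 3 k0 l0
        by (intro exI[of _ "F v $ 3 / (l * k * v $ 3)"]) (simp add: vec_eq_iff forall_3)
    qed
  qed
qed

lemma preserves_orthogonality_imp_isometry_up_to_sign:
  assumes unit: "\<And>x. norm x = 1 \<Longrightarrow> norm (f x) = 1" and f: "preserves_eq f 0"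
  obtains g where "\<And>x y. g x \<bullet> g y = x \<bullet> y" "\<And>x. norm x = 1 \<Longrightarrow> f x = g x \<or> f x = - g x"
proof -
  have orth: "f x \<bullet> f y = 0 \<longleftrightarrow> x \<bullet> y = 0" if "norm x = 1" "norm y = 1" for x y
    using f that unfolding preserves_eq_def by auto
  define M :: "real^3^3" where "M = (\<chi> i. f (axis i 1))"
  have e: "norm (f (axis i 1)) = 1" for i :: 3 using unit[of "axis i 1"] by (simp add: norm_axis_1)
  have ee: "f (axis i 1) \<bullet> f (axis j 1) = 0" if "i \<noteq> j" for i j
    using orth[of "axis i 1" "axis j 1"] that by (simp add: norm_axis_1 inner_axis_axis)
  have "orthogonal_matrix M"
    unfolding orthogonal_matrix_orthonormal_rows
    using e ee by (auto simp: row_def M_def orthogonal_def)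
  then have T: "orthogonal_transformation ((*v) M)"
    by (simp add: orthogonal_transformation_matrix)
  have Tf: "(M *v x) $ i = f (axis i 1) \<bullet> x" for x i
    by (simp add: M_def matrix_vector_mult_def inner_vec_def)
  define F where "F v = M *v f (sgn v)" for v
  have nF: "norm (F v) = 1" if "v \<noteq> 0" for v
    using that unit[of "sgn v"] orthogonal_transformation_norm[OF T] by (simp add: F_def norm_sgn)
  have Fnz: "F v \<noteq> 0" if "v \<noteq> 0" for v using nF[OF that] by auto
  have Forth: "v \<bullet> w = 0 \<longleftrightarrow> F v \<bullet> F w = 0" if "v \<noteq> 0" "w \<noteq> 0" for v w
  proof -
    have "F v \<bullet> F w = f (sgn v) \<bullet> f (sgn w)"
      using T by (simp add: F_def orthogonal_transformation_def)
    moreover have "\<dots> = 0 \<longleftrightarrow> sgn v \<bullet> sgn w = 0" using that by (intro orth) (simp_all add: norm_sgn)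
    ultimately show ?thesis using that by (simp add: sgn_div_norm)
  qed
  have Fax: "F (axis i 1) $ j = 0" if "i \<noteq> j" for i j
  proof -
    have "sgn (axis i (1::real)) = (axis i 1 :: real^3)" by (simp add: sgn_div_norm norm_axis_1)
    then show ?thesis using ee[of j i] that by (simp add: F_def Tf)
  qed
  obtain s t where st: "s\<^sup>2 = 1" "t\<^sup>2 = 1"
    "\<And>v. v \<noteq> 0 \<Longrightarrow> \<exists>c. F v = c *\<^sub>R vector [v $ 1, s * v $ 2, t * v $ 3]"
    using orthogonality_preserving_coordinates[OF Fnz Forth Fax] by blast
  define D :: "real^3 \<Rightarrow> real^3" where "D v = vector [v $ 1, s * v $ 2, t * v $ 3]" for v
  have st': "s * s = 1" "t * t = 1" using st by (simp_all add: power2_eq_square)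
  have D: "D x \<bullet> D y = x \<bullet> y" for x y
  proof -
    have "D x \<bullet> D y = x $ 1 * y $ 1 + (s * s) * (x $ 2 * y $ 2) + (t * t) * (x $ 3 * y $ 3)"
      by (simp add: D_def inner_vec_def sum_3 algebra_simps)
    then show ?thesis by (simp add: st' inner_vec_def sum_3)
  qed
  define T' where "T' = inv ((*v) M)"
  have T': "orthogonal_transformation T'" unfolding T'_def by (rule orthogonal_transformation_inv[OF T])
  have inv: "T' (M *v x) = x" for x
    unfolding T'_def using orthogonal_transformation_inj[OF T] by (rule inv_f_f)
  show ?thesis
  proof (rule that[of "\<lambda>x. T' (D x)"])
    show "T' (D x) \<bullet> T' (D y) = x \<bullet> y" for x y
      using T' D by (simp add: orthogonal_transformation_def)
    fix x :: "real^3" assume x: "norm x = 1"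
    then have x0: "x \<noteq> 0" by auto
    have Fx: "F x = M *v f x" using x by (simp add: F_def sgn_div_norm)
    obtain c where c: "F x = c *\<^sub>R D x" using st(3)[OF x0] by (auto simp: D_def)
    have "norm (D x) = 1" using D[of x x] x by (simp add: norm_eq_1)
    then have "\<bar>c\<bar> = 1" using nF[OF x0] c by simp
    then have "c = 1 \<or> c = - 1" by linarith
    moreover have "f x = c *\<^sub>R T' (D x)"
      using inv[of "f x"] c Fx orthogonal_transformation_linear[OF T'] by (metis linear_cmul)
    ultimately show "f x = T' (D x) \<or> f x = - T' (D x)" by auto
  qed
qed

lemma preserves_eq_imp_isometry:
  assumes f: "bij_betw f (sphere 0 1) (sphere 0 1)" and c: "preserves_eq f c" "c \<noteq> 0" "c\<^sup>2 < 1"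
    and xy: "norm x = 1" "norm y = 1"
  shows "f x \<bullet> f y = x \<bullet> y"
proof -
  have unit: "norm (f x) = 1" if "norm x = 1" for x
    using bij_betwE[OF f] that by auto
  have fc: "f x \<bullet> f y = c \<longleftrightarrow> x \<bullet> y = c" if "norm x = 1" "norm y = 1" for x y
    using c(1) that unfolding preserves_eq_def by auto
  consider "\<forall>x\<in>sphere 0 1. \<forall>y\<in>sphere 0 1. f x \<bullet> f y = x \<bullet> y" | "2 * c\<^sup>2 \<le> 1" "preserves_eq f 0"
    using preserves_eq_dichotomy[OF f c] by blast
  then show ?thesis
  proof cases
    case 1
    then show ?thesis using xy by simp
  next
    case 2
    obtain g where g: "\<And>x y. g x \<bullet> g y = x \<bullet> y" "\<And>x. norm x = 1 \<Longrightarrow> f x = g x \<or> f x = - g x"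
      using preserves_orthogonality_imp_isometry_up_to_sign[OF unit 2(2)] by blast
    define e where "e x = f x \<bullet> g x" for x
    have e: "f x = e x *\<^sub>R g x" "e x = 1 \<or> e x = - 1" if "norm x = 1" for x
      using g(2)[OF that] g(1)[of x x] that by (auto simp: e_def norm_eq_1)
    have adj: "e x = e r" if "norm x = 1" "norm r = 1" "x \<bullet> r = c" for x r
    proof -
      have "e x * e r * c = c"
        using fc[OF that(1,2)] that(3) e(1)[OF that(1)] e(1)[OF that(2)] g(1)[of x r] by (simp add: mult.commute)
      then show ?thesis using e(2)[OF that(1)] e(2)[OF that(2)] c(2) by auto
    qed
    have near: "e x = e y" if n: "norm x = 1" "norm y = 1" "0 \<le> x \<bullet> y" for x y
    proof -
      have "2 * c\<^sup>2 - 1 \<le> x \<bullet> y" using 2(1) n by simp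
      with common_neighbours[OF n(1,2) c(2)] obtain r where "norm r = 1" "x \<bullet> r = c" "y \<bullet> r = c"
        by blast
      then show ?thesis using adj n by metis
    qed
    obtain n where "norm n = 1" "n \<bullet> x = 0" "n \<bullet> y = 0" using ex_unit_normal by blast
    then have "e x = e y" using near[of n x] near[of n y] xy by simp
    then show ?thesis
      using e[OF xy(1)] e(1)[OF xy(2)] g(1)[of x y] by auto
  qed
qed

subsection \<open>The Bloch sphere\<close>

definition bloch :: "complex^2 \<Rightarrow> real^3"
  where "bloch v = vector [2 * Re (v $ 1 * cnj (v $ 2)), 2 * Im (v $ 1 * cnj (v $ 2)),
    (cmod (v $ 1))\<^sup>2 - (cmod (v $ 2))\<^sup>2]"

lemma norm_complex2: "(norm (v :: complex^2))\<^sup>2 = (cmod (v $ 1))\<^sup>2 + (cmod (v $ 2))\<^sup>2"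
  by (simp add: norm_vec_def L2_set_def sum_2)

lemma bloch_inner: "bloch u \<bullet> bloch v = 2 * (cmod (cinner u v))\<^sup>2 - (norm u)\<^sup>2 * (norm v)\<^sup>2"
  unfolding norm_complex2 bloch_def cinner_def sum_2 cmod_power2
  by (simp add: inner_vec_def sum_3) (simp add: power2_eq_square algebra_simps)

lemma norm_bloch: "norm v = 1 \<Longrightarrow> norm (bloch v) = 1"
  unfolding norm_eq_1[of "bloch v"] bloch_inner cinner_self by simp

lemma bloch_surj:
  assumes "norm x = 1"
  obtains v where "norm v = 1" "bloch v = x"
proof -
  have x: "(x $ 1)\<^sup>2 + (x $ 2)\<^sup>2 + (x $ 3)\<^sup>2 = 1"
    using assms by (simp add: norm_eq_1 inner_vec_def sum_3 power2_eq_square)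
  then have x3: "- 1 \<le> x $ 3" using power2_le_imp_le[of "- (x $ 3)" 1] zero_le_power2[of "x $ 1"] zero_le_power2[of "x $ 2"]
    by (simp add: abs_le_iff)
  show ?thesis
  proof (cases "x $ 3 = - 1")
    case True
    then have "x $ 1 = 0" "x $ 2 = 0" using x by (simp_all add: sum_power2_eq_zero_iff)
    then show ?thesis using True
      by (intro that[of "vector [0, 1]"])
         (simp_all add: bloch_def vec_eq_iff forall_3 norm_vec_def L2_set_def sum_2)
  next
    case False
    define a where "a = sqrt ((1 + x $ 3) / 2)"
    have a: "0 < a" "a * a = (1 + x $ 3) / 2" using False x3 by (simp_all add: a_def)
    define b where "b = Complex (x $ 1 / (2 * a)) (- x $ 2 / (2 * a))"
    have b: "(cmod b)\<^sup>2 = (1 - x $ 3) / 2"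
    proof -
      have "(cmod b)\<^sup>2 = (x $ 1 / (2 * a))\<^sup>2 + (x $ 2 / (2 * a))\<^sup>2"
        by (simp add: b_def cmod_power2)
      then have "(cmod b)\<^sup>2 * (4 * (a * a)) = (x $ 1)\<^sup>2 + (x $ 2)\<^sup>2"
        using a(1) by (simp add: power2_eq_square field_simps)
      also have "\<dots> = (1 - x $ 3) / 2 * (4 * (a * a))"
        using x unfolding a(2) by (simp add: power2_eq_square field_simps)
      finally show ?thesis using a(1) by simp
    qed
    define v :: "complex^2" where "v = vector [of_real a, b]"
    have v: "v $ 1 = of_real a" "v $ 2 = b" by (simp_all add: v_def)
    have "(norm v)\<^sup>2 = 1" unfolding norm_complex2 v b using a by (simp add: power2_eq_square field_simps)
    then have "norm v = 1" using power2_eq_iff_nonneg[of "norm v" 1] by simp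
    moreover have "bloch v = x"
      using a b by (simp add: bloch_def v vec_eq_iff forall_3 power2_eq_square)
         (simp add: b_def field_simps)
    ultimately show ?thesis by (rule that)
  qed
qed

lemma cinner_commute: "cinner v u = cnj (cinner u v)"
  by (simp add: cinner_def sum_2 mult.commute)

lemma cinner_simps:
  "cinner (u + v) w = cinner u w + cinner v w" "cinner u (v + w) = cinner u v + cinner u w"
  "cinner (u - v) w = cinner u w - cinner v w" "cinner u (v - w) = cinner u v - cinner u w"
  "cinner (a *s u) v = a * cinner u v" "cinner u (a *s v) = cnj a * cinner u v"
  by (simp_all add: cinner_def sum_2 algebra_simps)

lemma cinner_self_eq_1: "norm v = 1 \<Longrightarrow> cinner v v = 1"
  by (simp add: cinner_self)

lemma cinner_self_eq_0: "cinner v v = 0 \<longleftrightarrow> v = 0"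
  by (simp add: cinner_self)

lemma line_scale:
  assumes "c \<noteq> 0"
  shows "line (c *s v) = line v"
  unfolding line_def
  using vec.span_image_scale[of "{v}" "\<lambda>_. c"] assms by simp

lemma lines_unit:
  assumes "L \<in> lines"
  obtains v where "norm v = 1" "L = line v"
proof -
  obtain v where v: "v \<noteq> 0" "L = line v" using assms by (auto simp: in_lines_iff)
  define w where "w = of_real (1 / norm v) *s v"
  have "norm w = 1" "line w = line v"
    using v unfolding w_def by (simp_all only: norm_smult norm_of_real, simp_all add: line_scale)
  with that v show ?thesis by simp
qed

lemma line_eq_iff_bloch:
  assumes "norm u = 1" "norm v = 1"
  shows "line u = line v \<longleftrightarrow> bloch u = bloch v"
proof
  assume eq: "line u = line v"
  have "u \<noteq> 0" using assms by auto
  then obtain c where c: "u = c *s v" using line_eqD eq by metis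
  then have "cmod c = 1" using assms by (simp add: norm_smult)
  then have "bloch u \<bullet> bloch v = 1"
    using assms by (simp add: bloch_inner c norm_smult cinner_simps cinner_self_eq_1 norm_mult)
  then show "bloch u = bloch v" using unit_inner_eq_1 norm_bloch assms by blast
next
  assume "bloch u = bloch v"
  then have "bloch u \<bullet> bloch v = 1" using norm_bloch[OF assms(1)] by (simp add: norm_eq_1)
  then have *: "(cmod (cinner u v))\<^sup>2 = 1" using assms by (simp add: bloch_inner)
  define c where "c = cinner u v"
  have "cinner (u - c *s v) (u - c *s v) = 1 - c * cnj c"
    using assms by (simp add: cinner_simps cinner_self_eq_1 cinner_commute[of v u] c_def[symmetric] algebra_simps)
  also have "\<dots> = 0" using * by (simp add: c_def flip: complex_norm_square)
  finally have "u = c *s v" by (simp add: cinner_self_eq_0)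
  moreover have "c \<noteq> 0" using * by (auto simp: c_def)
  ultimately show "line u = line v" by (simp add: line_scale)
qed

lemma perp_line_bloch:
  assumes "norm u = 1" "norm v = 1" "bloch v = - bloch u"
  shows "perp_line (line u) = line v"
proof -
  have "bloch u \<bullet> bloch v = - 1" using assms(3) norm_bloch[OF assms(1)] by (simp add: norm_eq_1)
  then have "cinner u v = 0" using bloch_inner[of u v] assms(1,2) by simp
  then have "\<forall>x\<in>line u. \<forall>y\<in>line v. cinner x y = 0" by (auto simp: line_eq cinner_simps)
  moreover have "u \<noteq> 0" "v \<noteq> 0" using assms by auto
  ultimately show ?thesis
    unfolding perp_line_def
    by (intro the1_equality[OF perp_line_unique] conjI line_in_lines)
qed

lemma line_angle_eq_iff:
  assumes "norm u = 1" "norm v = 1" "0 \<le> \<alpha>" "\<alpha> \<le> pi / 2"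
  shows "line_angle (line u) (line v) = \<alpha> \<longleftrightarrow> bloch u \<bullet> bloch v = cos (2 * \<alpha>)"
proof -
  have b: "bloch u \<bullet> bloch v = 2 * (cmod (cinner u v))\<^sup>2 - 1" using assms by (simp add: bloch_inner)
  have "(cmod (cinner u v))\<^sup>2 \<le> 1\<^sup>2"
    using unit_inner_bounds(2)[of "bloch u" "bloch v"] assms by (simp add: b norm_bloch)
  then have c: "cmod (cinner u v) \<le> 1" by (rule power2_le_imp_le) simp
  have ca: "0 \<le> cos \<alpha>" using assms by (intro cos_ge_zero) auto
  have "u \<noteq> 0" "v \<noteq> 0" using assms by auto
  then have "line_angle (line u) (line v) = arccos (cmod (cinner u v))"
    using assms by (simp add: line_angle_line)
  moreover have "arccos (cmod (cinner u v)) = \<alpha> \<longleftrightarrow> cmod (cinner u v) = cos \<alpha>"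
  proof
    assume "arccos (cmod (cinner u v)) = \<alpha>"
    moreover have "cos (arccos (cmod (cinner u v))) = cmod (cinner u v)"
      using c norm_ge_zero[of "cinner u v"] by (intro cos_arccos) linarith+
    ultimately show "cmod (cinner u v) = cos \<alpha>" by simp
  next
    assume "cmod (cinner u v) = cos \<alpha>"
    then show "arccos (cmod (cinner u v)) = \<alpha>" using assms by (simp add: arccos_cos)
  qed
  moreover have "\<dots> \<longleftrightarrow> (cmod (cinner u v))\<^sup>2 = (cos \<alpha>)\<^sup>2" using ca by (simp add: power2_eq_iff_nonneg)
  ultimately show ?thesis by (simp add: b cos_double_cos)
qed

subsection \<open>Lifting isometries of the sphere\<close>

lemma unitary_of_orthonormal:
  assumes "norm w1 = 1" "norm w2 = 1" "cinner w1 w2 = 0"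
  shows "unitary (\<lambda>v. v $ 1 *s w1 + v $ 2 *s w2)" (is "unitary ?U")
proof -
  have "cinner w2 w1 = 0" using assms(3) cinner_commute[of w2 w1] by simp
  then have inn: "cinner (?U x) (?U y) = cinner x y" for x y
    using assms by (simp add: cinner_simps cinner_self_eq_1) (simp add: cinner_def sum_2)
  have lin: "clinear_map ?U"
    unfolding clinear_map_def Vector_Spaces.linear_iff
    by (simp add: vec.vector_space_axioms vec_eq_iff algebra_simps)
  have "inj ?U"
  proof (rule injI)
    fix x y assume eq: "?U x = ?U y"
    have "?U (x - y) = ?U x - ?U y" by (simp add: vec_eq_iff algebra_simps)
    then have "?U (x - y) = 0" using eq by simp
    then have "cinner (x - y) (x - y) = 0" using inn[of "x - y" "x - y"] by (simp add: cinner_def)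
    then show "x = y" by (simp add: cinner_self_eq_0)
  qed
  then show ?thesis
    using lin inn vec.linear_inj_imp_surj[of ?U] by (simp add: unitary_def bij_def clinear_map_def)
qed

definition conj_vec :: "complex^2 \<Rightarrow> complex^2"
  where "conj_vec v = (\<chi> i. cnj (v $ i))"

lemma antiunitary_comp_conj_vec:
  assumes "unitary U"
  shows "antiunitary (U \<circ> conj_vec)"
proof -
  have "conj_vec \<circ> conj_vec = id" by (simp add: fun_eq_iff conj_vec_def vec_eq_iff)
  then have "bij conj_vec" by (rule o_bij) fact
  moreover have "cinner (conj_vec x) (conj_vec y) = cnj (cinner x y)" for x y
    by (simp add: conj_vec_def cinner_def)
  moreover have "conj_linear_map (U \<circ> conj_vec)"
  proof -
    have "conj_vec (x + y) = conj_vec x + conj_vec y" "conj_vec (c *s x) = cnj c *s conj_vec x" for x y c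
      by (simp_all add: conj_vec_def vec_eq_iff)
    then show ?thesis
      using assms
      by (simp add: unitary_def clinear_map_def conj_linear_map_def vec.linear_add vec.linear_scale)
  qed
  ultimately show ?thesis
    using assms by (simp add: antiunitary_def unitary_def bij_comp)
qed

lemma unitary_or_antiunitary_norm:
  assumes "unitary U \<or> antiunitary U"
  shows "norm (U v) = norm v"
proof -
  have "cinner (U v) (U v) = cinner v v \<or> cinner (U v) (U v) = cnj (cinner v v)"
    using assms unfolding unitary_def antiunitary_def by blast
  then have "cinner (U v) (U v) = cinner v v" by (auto simp: cinner_self)
  then have "(norm (U v))\<^sup>2 = (norm v)\<^sup>2" unfolding cinner_self of_real_eq_iff .
  then show ?thesis by simp
qed

lemma unitary_or_antiunitary_isometry:
  assumes "unitary U \<or> antiunitary U"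
  shows "isometry U"
proof -
  have "U (x - y) = U x - U y" for x y
  proof -
    have "U (x - y + y) = U (x - y) + U y"
      using assms unfolding unitary_def antiunitary_def clinear_map_def conj_linear_map_def
      using vec.linear_add by blast
    then show ?thesis by simp
  qed
  then show ?thesis
    using unitary_or_antiunitary_norm[OF assms] by (simp add: isometry_def dist_norm flip: \<open>\<And>x y. U (x - y) = U x - U y\<close>)
qed

lemma line_unitary_or_antiunitary_scale:
  assumes "unitary U \<or> antiunitary U" "c \<noteq> 0"
  shows "line (U (c *s v)) = line (U v)"
proof -
  have "U (c *s v) = c *s U v \<or> U (c *s v) = cnj c *s U v"
    using assms unfolding unitary_def antiunitary_def clinear_map_def conj_linear_map_def
    using vec.linear_scale by blast
  then show ?thesis using assms(2) line_scale[of c] line_scale[of "cnj c"] by auto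
qed

lemma eq_0_if_orthogonal_to_basis:
  fixes x :: "real^3"
  assumes e: "norm e1 = 1" "norm e2 = 1" "norm e3 = 1" "e1 \<bullet> e2 = 0" "e1 \<bullet> e3 = 0" "e2 \<bullet> e3 = 0"
    and x: "x \<bullet> e1 = 0" "x \<bullet> e2 = 0" "x \<bullet> e3 = 0"
  shows "x = 0"
proof -
  have "cross3 x e3 = 0"
    by (rule cross3_orthogonal_eq_0[of e1 e2]) (use e x in \<open>auto simp: inner_commute\<close>)
  then show ?thesis using norm_cross_dot[of x e3] e x by simp
qed

lemma bloch_lift:
  assumes g: "\<And>x y. norm x = 1 \<Longrightarrow> norm y = 1 \<Longrightarrow> g x \<bullet> g y = x \<bullet> y"
  obtains U where "unitary U \<or> antiunitary U" "\<And>v. norm v = 1 \<Longrightarrow> bloch (U v) = g (bloch v)"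
proof -
  have ng: "norm (g x) = 1" if "norm x = 1" for x using g[OF that that] that by (simp add: norm_eq_1)
  define G where "G i = g (axis i 1)" for i
  have nG: "norm (G i) = 1" for i using ng[of "axis i 1"] by (simp add: G_def norm_axis_1)
  have G0: "G i \<noteq> 0" for i using nG[of i] by auto
  have GG: "G i \<bullet> G j = (if i = j then 1 else 0)" for i j
    using g[of "axis i 1" "axis j 1"] by (simp add: G_def norm_axis_1 inner_axis_axis)
  obtain u1 where u1: "norm u1 = 1" "bloch u1 = G 3" using bloch_surj[OF nG] .
  obtain u2 where u2: "norm u2 = 1" "bloch u2 = - G 3" using bloch_surj[of "- G 3"] nG by auto
  obtain u3 where u3: "norm u3 = 1" "bloch u3 = G 1" using bloch_surj[OF nG] .
  have u12: "cinner u1 u2 = 0"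
    using bloch_inner[of u1 u2] u1 u2 GG[of 3 3] by simp
  have half: "2 * (cmod (cinner u3 u1))\<^sup>2 = 1" "2 * (cmod (cinner u3 u2))\<^sup>2 = 1"
    using bloch_inner[of u3 u1] bloch_inner[of u3 u2] u1 u2 u3 GG[of 1 3] by simp_all
  define p where "p = complex_of_real (sqrt 2) * cinner u3 u1"
  define q where "q = complex_of_real (sqrt 2) * cinner u3 u2"
  have "(cmod p)\<^sup>2 = 1" "(cmod q)\<^sup>2 = 1"
    using half by (simp_all add: p_def q_def norm_mult power_mult_distrib)
  then have pq: "cmod p = 1" "cmod q = 1"
    using power2_eq_iff_nonneg[of "cmod p" 1] power2_eq_iff_nonneg[of "cmod q" 1] by simp_all
  then have p0: "p \<noteq> 0" "q \<noteq> 0" by auto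
  define w1 w2 where "w1 = p *s u1" and "w2 = q *s u2"
  have w: "norm w1 = 1" "norm w2 = 1" "cinner w1 w2 = 0"
    using pq u1 u2 u12 by (simp_all add: w1_def w2_def norm_smult cinner_simps)
  define U where "U v = v $ 1 *s w1 + v $ 2 *s w2" for v :: "complex^2"
  have U: "unitary U" using unitary_of_orthonormal[OF w] by (simp add: U_def[abs_def])
  have nU: "norm (U v) = norm v" for v using unitary_or_antiunitary_norm U by blast
  have UU: "bloch (U u) \<bullet> bloch (U v) = bloch u \<bullet> bloch v" for u v
    using U by (simp add: bloch_inner nU unitary_def)
  define h where "h = complex_of_real (1 / sqrt 2)"
  have hh: "h * cnj h = 1 / 2" "cmod h = 1 / sqrt 2"
    by (simp_all add: h_def norm_divide flip: of_real_mult)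
  define v1 v2 v3 :: "complex^2" where "v1 = vector [h, h]" and "v2 = vector [h, - \<i> * h]"
    and "v3 = vector [1, 0]"
  have nv: "norm v1 = 1" "norm v2 = 1" "norm v3 = 1"
    by (simp_all add: v1_def v2_def v3_def norm_vec_def L2_set_def sum_2 hh norm_mult power_divide)
  have hc: "h * h = 1 / 2" "cnj h = h" using hh by (simp_all add: h_def)
  have hr: "Re h * Re h = 1 / 2" "Im h = 0" by (simp_all add: h_def)
  have bv: "bloch v1 = axis 1 1" "bloch v2 = axis 2 1" "bloch v3 = axis 3 1"
    by (simp_all add: bloch_def v1_def v2_def v3_def vec_eq_iff forall_3 axis_def hc hr norm_mult)
  have B3: "bloch (U v3) = G 3"
  proof -
    have "U v3 = p *s u1" by (simp add: U_def v3_def w1_def)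
    then have "line (U v3) = line u1" using p0 by (simp add: line_scale)
    then show ?thesis using line_eq_iff_bloch[of "U v3" u1] nU nv u1 by simp
  qed
  have B1: "bloch (U v1) = G 1"
  proof -
    have s: "cnj p * cinner u3 u1 = h" "cnj q * cinner u3 u2 = h"
    proof -
      have "cnj (complex_of_real (sqrt 2) * z) * z = h" if "2 * (cmod z)\<^sup>2 = 1" for z
      proof -
        have "cnj (complex_of_real (sqrt 2) * z) * z = of_real (sqrt 2) * of_real ((cmod z)\<^sup>2)"
          unfolding complex_norm_square by simp
        also have "(cmod z)\<^sup>2 = 1 / 2" using that by simp
        finally show ?thesis by (simp add: h_def field_simps flip: of_real_mult)
      qed
      then show "cnj p * cinner u3 u1 = h" "cnj q * cinner u3 u2 = h"
        using half by (simp_all only: p_def q_def)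
    qed
    have "cinner u3 (U v1) = h * (cnj p * cinner u3 u1) + h * (cnj q * cinner u3 u2)"
      by (simp add: U_def v1_def w1_def w2_def cinner_simps hc mult.assoc)
    also have "\<dots> = 1" by (simp add: s hc)
    finally have "bloch u3 \<bullet> bloch (U v1) = 1"
      using u3(1) nU nv by (simp add: bloch_inner)
    then show ?thesis using unit_inner_eq_1[of "bloch u3" "bloch (U v1)"] u3 nU nv nG norm_bloch by simp
  qed
  define m where "m = bloch (U v2)"
  have m: "norm m = 1" "m \<bullet> G 1 = 0" "m \<bullet> G 3 = 0"
    using UU[of v2 v1] UU[of v2 v3] norm_bloch[of "U v2"] nU nv
    by (simp_all add: m_def B1 B3 bv inner_axis_axis)
  have "cross3 m (G 2) = 0"
    by (rule cross3_orthogonal_eq_0[of "G 1" "G 3"])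
       (use GG m G0 in \<open>simp_all add: inner_commute\<close>)
  then have "(m \<bullet> G 2)\<^sup>2 = 1" using norm_cross_dot[of m "G 2"] m nG by simp
  then have "m \<bullet> G 2 = 1 \<or> - m \<bullet> G 2 = 1" by (auto simp: power2_eq_1_iff)
  then have mG: "G 2 = m \<or> G 2 = - m"
    using unit_inner_eq_1[of m "G 2"] unit_inner_eq_1[of "- m" "G 2"] m nG by auto
  have coord: "bloch (U v) \<bullet> G 1 = bloch v $ 1" "bloch (U v) \<bullet> m = bloch v $ 2"
    "bloch (U v) \<bullet> G 3 = bloch v $ 3" for v
    using UU[of v v1] UU[of v v2] UU[of v v3] by (simp_all add: B1 B3 m_def[symmetric] bv inner_axis)
  have gG: "g x \<bullet> G i = x $ i" if "norm x = 1" for x i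
    using g[OF that, of "axis i 1"] by (simp add: G_def norm_axis_1 inner_axis)
  have eqI: "y = g x" if "norm x = 1" "y \<bullet> G 1 = x $ 1" "y \<bullet> G 2 = x $ 2" "y \<bullet> G 3 = x $ 3" for x y
    using eq_0_if_orthogonal_to_basis[of "G 1" "G 2" "G 3" "y - g x"] nG GG that gG
    by (simp add: inner_diff_left)
  show ?thesis
    using mG
  proof
    assume "G 2 = m"
    then show ?thesis
      using U coord norm_bloch by (intro that[of U] eqI) auto
  next
    assume 2: "G 2 = - m"
    have "bloch (conj_vec v) = vector [bloch v $ 1, - bloch v $ 2, bloch v $ 3]" for v
      by (simp add: bloch_def conj_vec_def vec_eq_iff forall_3)
    then show ?thesis
      using antiunitary_comp_conj_vec[OF U] coord norm_bloch
      by (intro that[of "U \<circ> conj_vec"] eqI) (auto simp: 2)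
  qed
qed

theorem theorem3:
  fixes \<alpha> :: real and \<phi> :: "(complex^2) set \<Rightarrow> (complex^2) set"
  assumes "0 < \<alpha>" "\<alpha> < pi / 2"
    and "bij_betw \<phi> lines lines"
    and "\<And>L M. L \<in> lines \<Longrightarrow> M \<in> lines \<Longrightarrow>
           line_angle L M = \<alpha> \<longleftrightarrow> line_angle (\<phi> L) (\<phi> M) = \<alpha>"
  shows "(\<alpha> \<noteq> pi / 4 \<longrightarrow> wigner_symmetry \<phi>) \<and>
         (\<alpha> = pi / 4 \<longrightarrow>
           (\<exists>U. (unitary U \<or> antiunitary U) \<and>
                (\<forall>v. v \<noteq> 0 \<longrightarrow> \<phi> (line v) \<in> {line (U v), perp_line (line (U v))})))"
proof -
  let ?S = "sphere (0::real^3) 1"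
  define c where "c = cos (2 * \<alpha>)"
  define \<beta> where "\<beta> L = bloch (SOME v. norm v = 1 \<and> L = line v)" for L
  have \<beta>: "\<beta> (line v) = bloch v" if "norm v = 1" for v
  proof -
    have "norm (SOME w. norm w = 1 \<and> line v = line w) = 1 \<and> line v = line (SOME w. norm w = 1 \<and> line v = line w)"
      by (rule someI) (use that in blast)
    then show ?thesis unfolding \<beta>_def using line_eq_iff_bloch that by metis
  qed
  have unit_lines: "line v \<in> lines" if "norm v = 1" for v using that by (intro line_in_lines) auto
  have bij: "bij_betw \<beta> lines ?S"
  proof (rule bij_betw_imageI)
    show "inj_on \<beta> lines"
    proof (rule inj_onI)
      fix L M assume LM: "L \<in> lines" "M \<in> lines" "\<beta> L = \<beta> M"
      obtain u where u: "norm u = 1" "L = line u" using lines_unit[OF LM(1)] .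
      obtain v where v: "norm v = 1" "M = line v" using lines_unit[OF LM(2)] .
      show "L = M" using LM(3) u v \<beta> line_eq_iff_bloch[OF u(1) v(1)] by simp
    qed
    show "\<beta> ` lines = ?S"
    proof
      show "\<beta> ` lines \<subseteq> ?S"
      proof
        fix x assume "x \<in> \<beta> ` lines"
        then obtain L where "L \<in> lines" "x = \<beta> L" by blast
        moreover then obtain v where "norm v = 1" "L = line v" using lines_unit by blast
        ultimately show "x \<in> ?S" using \<beta> norm_bloch by simp
      qed
      show "?S \<subseteq> \<beta> ` lines"
      proof
        fix x assume "x \<in> ?S"
        then have "norm x = 1" by simp
        then obtain v where v: "norm v = 1" "bloch v = x" using bloch_surj by blast
        then show "x \<in> \<beta> ` lines" using \<beta>[OF v(1)] unit_lines[OF v(1)] by (auto intro: rev_image_eqI)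
      qed
    qed
  qed
  define f where "f = \<beta> \<circ> \<phi> \<circ> inv_into lines \<beta>"
  have f: "bij_betw f ?S ?S"
    unfolding f_def comp_assoc
    by (intro bij_betw_trans[OF bij_betw_trans[OF bij_betw_inv_into[OF bij] assms(3)] bij, unfolded comp_assoc])
  have \<phi>: "\<exists>w. norm w = 1 \<and> \<phi> (line v) = line w \<and> f (bloch v) = bloch w" if "norm v = 1" for v
  proof -
    have "\<phi> (line v) \<in> lines" using assms(3) unit_lines[OF that] by (meson bij_betwE)
    then obtain w where w: "norm w = 1" "\<phi> (line v) = line w" using lines_unit by blast
    have "inv_into lines \<beta> (bloch v) = line v"
      using bij_betw_inv_into_left[OF bij unit_lines[OF that]] \<beta>[OF that] by simp
    then have "f (bloch v) = bloch w" using w \<beta> by (simp add: f_def)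
    with w show ?thesis by blast
  qed
  have eq: "preserves_eq f c"
    unfolding preserves_eq_def
  proof (intro ballI)
    fix x y assume "x \<in> ?S" "y \<in> ?S"
    then have xy: "norm x = 1" "norm y = 1" by auto
    obtain u where u: "norm u = 1" "bloch u = x" using bloch_surj[OF xy(1)] .
    obtain v where v: "norm v = 1" "bloch v = y" using bloch_surj[OF xy(2)] .
    note uv = u v
    obtain u' v' where u': "norm u' = 1" "\<phi> (line u) = line u'" "f x = bloch u'"
      and v': "norm v' = 1" "\<phi> (line v) = line v'" "f y = bloch v'"
      using \<phi>[of u] \<phi>[of v] uv by auto
    show "x \<bullet> y = c \<longleftrightarrow> f x \<bullet> f y = c"
      using line_angle_eq_iff[of u v \<alpha>] line_angle_eq_iff[of u' v' \<alpha>] assms(1,2) uv u' v'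
        assms(4)[OF unit_lines unit_lines, of u v]
      by (simp add: c_def)
  qed
  have unit: "norm (f x) = 1" if "norm x = 1" for x using bij_betwE[OF f] that by auto
  have extend: "P (\<phi> (line v)) (line (U v))"
    if U: "unitary U \<or> antiunitary U" and v: "v \<noteq> 0"
      and P: "\<And>v. norm v = 1 \<Longrightarrow> P (\<phi> (line v)) (line (U v))" for U v P
  proof -
    obtain w where w: "norm w = 1" "line v = line w" using lines_unit[OF line_in_lines[OF v]] by blast
    obtain d where "d \<noteq> 0" "v = d *s w" using line_eqD[OF v w(2)] .
    then show ?thesis
      using P[OF w(1)] line_unitary_or_antiunitary_scale[OF U] w by simp
  qed
  have "wigner_symmetry \<phi>" if "\<alpha> \<noteq> pi / 4"
  proof -
    have c0: "c \<noteq> 0"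
    proof
      assume "c = 0"
      then have "arccos (cos (2 * \<alpha>)) = pi / 2" by (simp add: c_def)
      then show False using that assms by (simp add: arccos_cos)
    qed
    have "0 < (sin (2 * \<alpha>))\<^sup>2" using sin_gt_zero[of "2 * \<alpha>"] assms by simp
    then have "c\<^sup>2 < 1" unfolding sin_squared_eq c_def by simp
    from preserves_eq_imp_isometry[OF f eq c0 this]
    obtain U where U: "unitary U \<or> antiunitary U" "\<And>v. norm v = 1 \<Longrightarrow> bloch (U v) = f (bloch v)"
      using bloch_lift[of f] by metis
    have "\<phi> (line v) = line (U v)" if v: "norm v = 1" for v
    proof -
      obtain w where "norm w = 1" "\<phi> (line v) = line w" "f (bloch v) = bloch w" using \<phi>[OF v] by blast
      then show ?thesis
        using U(2)[OF v] line_eq_iff_bloch[of w "U v"] unitary_or_antiunitary_norm[OF U(1), of v] v by simp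
    qed
    then have "\<phi> (line v) = line (U v)" if "v \<noteq> 0" for v
      using extend[OF U(1) that, of "(=)"] by blast
    moreover have "bij U" "clinear_map U \<or> conj_linear_map U"
      using U(1) by (auto simp: unitary_def antiunitary_def)
    ultimately show ?thesis
      unfolding wigner_symmetry_def using unitary_or_antiunitary_isometry[OF U(1)] by blast
  qed
  moreover have "\<exists>U. (unitary U \<or> antiunitary U) \<and>
      (\<forall>v. v \<noteq> 0 \<longrightarrow> \<phi> (line v) \<in> {line (U v), perp_line (line (U v))})" if "\<alpha> = pi / 4"
  proof -
    have "c = 0" by (simp add: c_def that)
    with eq have "preserves_eq f 0" by simp
    then obtain g where g: "\<And>x y. g x \<bullet> g y = x \<bullet> y" "\<And>x. norm x = 1 \<Longrightarrow> f x = g x \<or> f x = - g x"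
      using preserves_orthogonality_imp_isometry_up_to_sign[of f, OF unit] by blast
    obtain U where U: "unitary U \<or> antiunitary U" "\<And>v. norm v = 1 \<Longrightarrow> bloch (U v) = g (bloch v)"
      using bloch_lift[OF g(1)] by blast
    have "\<phi> (line v) = line (U v) \<or> \<phi> (line v) = perp_line (line (U v))" if v: "norm v = 1" for v
    proof -
      obtain w where w: "norm w = 1" "\<phi> (line v) = line w" "f (bloch v) = bloch w" using \<phi>[OF v] by blast
      have nU: "norm (U v) = 1" using unitary_or_antiunitary_norm[OF U(1), of v] v by simp
      have "bloch w = bloch (U v) \<or> bloch w = - bloch (U v)"
        using g(2)[OF norm_bloch[OF v]] w(3) U(2)[OF v] by simp
      then show ?thesis
        using line_eq_iff_bloch[OF w(1) nU] perp_line_bloch[OF nU w(1)] w(2) by auto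
    qed
    then have "\<phi> (line v) = line (U v) \<or> \<phi> (line v) = perp_line (line (U v))" if "v \<noteq> 0" for v
      using extend[OF U(1) that, of "\<lambda>L M. L = M \<or> L = perp_line M"] by blast
    with U(1) show ?thesis by blast
  qed
  ultimately show ?thesis by blast
qed

end
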